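(* The subspace of $\textsf{ParSym}$ spanned by $\{\textsf{H}_\pi : \pi \text{ a planar partition diagram}\}$ is a Hopf subalgebra of $\textsf{ParSym}$: it contains $\textsf{H}_\varnothing$, is closed under the product, $\Delta$ maps it into its tensor square, and the antipode $S$ maps it into itself.
   Context: Partition diagrams of order $k$ are set partitions of $\{1,\ldots,k,1',\ldots,k'\}$, drawn with $1,\ldots,k$ in a top row and $1',\ldots,k'$ in a bottom row; $A_0=\{\varnothing\}$. A partition diagram is planar if it can be represented by a graph on these vertices whose connected components are the blocks, drawn with edges inside the rectangle spanned by the two rows, without edge crossings. For $\pi$ of order $k$, $\rho$ of order $l$: $\pi\otimes\rho$ has as blocks those of $\pi$ and those of $\rho$ shifted ($i\mapsto i+k$, $i'\mapsto(i+k)'$). A diagram is $\otimes$-irreducible if it is not $\rho^{(1)}\otimes\rho^{(2)}$ with both factors nonempty. For nonempty $\pi,\rho$ (orders $k,l$), $\pi\bullet\rho$ is obtained from $\pi\otimes\rho$ by merging the block containing $k'$ with the block containing $(k+1)'$; $\varnothing\bullet\rho=\rho$, $\pi\bullet\varnothing=\pi$. Over a field $\mathbbm{k}$, $\textsf{ParSym}$ has basis $\{\textsf{H}_\pi\}$ over all partition diagrams, product $\textsf{H}_\pi\textsf{H}_\rho=\textsf{H}_{\pi\otimes\rho}$, unit $\textsf{H}_\varnothing$ (free on $\textsf{H}_\pi$, $\pi$ nonempty $\otimes$-irreducible). $\Delta$ is the algebra morphism with $\Delta\textsf{H}_\varnothing=\textsf{H}_\varnothing\otimes\textsf{H}_\varnothing$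 and $\Delta\textsf{H}_\pi=\sum\textsf{H}_{G_1}\otimes\textsf{H}_{G_2}$ for nonempty $\otimes$-irreducible $\pi$, over ordered pairs $(G_1,G_2)$, each $\varnothing$ or $\otimes$-irreducible, with $G_1\bullet G_2=\pi$. $S$ is the linear antimorphism with $S(\textsf{H}_\varnothing)=\textsf{H}_\varnothing$ and $S(\textsf{H}_\pi)=\sum(-1)^\ell\textsf{H}_{\rho^{(1)}}\cdots\textsf{H}_{\rho^{(\ell)}}$ for nonempty $\otimes$-irreducible $\pi$, over tuples of nonempty diagrams with $\rho^{(1)}\bullet\cdots\bullet\rho^{(\ell)}=\pi$. *)

theory Defs
  imports "HOL-Analysis.Analysis" "HOL-Library.Poly_Mapping" "HOL-Library.Disjoint_Sets"
begin

section \<open>Partition diagrams\<close>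

text \<open>\<open>Top i\<close> is the vertex $i$ of the upper row, \<open>Bot i\<close> the vertex $i'$ of the lower row.\<close>

datatype vertex = Top nat | Bot nat

definition vertices :: "nat \<Rightarrow> vertex set" where
  "vertices k = Top ` {1..k} \<union> Bot ` {1..k}"

typedef diagram = "{(k, P). partition_on (vertices k) P}"
  by (rule exI[of _ "(0, {})"]) (simp add: vertices_def partition_on_def)

setup_lifting type_definition_diagram

lift_definition diagram_order :: "diagram \<Rightarrow> nat" is fst .

lift_definition blocks :: "diagram \<Rightarrow> vertex set set" is snd .

lemma partition_on_blocks: "partition_on (vertices (diagram_order \<pi>)) (blocks \<pi>)"
  by transfer auto

lemma diagram_eqI:
  "diagram_order \<pi> = diagram_order \<rho> \<Longrightarrow> blocks \<pi> = blocks \<rho> \<Longrightarrow> \<pi> = \<rho>"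
  by transfer (auto simp: prod_eq_iff)

lemma diagram_exists:
  assumes "partition_on (vertices k) P"
  obtains \<pi> where "diagram_order \<pi> = k" "blocks \<pi> = P"
proof -
  have "\<exists>\<pi>. diagram_order \<pi> = k \<and> blocks \<pi> = P"
    using assms by transfer auto
  then show ?thesis using that by blast
qed

primrec shift :: "nat \<Rightarrow> vertex \<Rightarrow> vertex" where
  "shift k (Top i) = Top (i + k)"
| "shift k (Bot i) = Bot (i + k)"

lemma inj_shift: "inj (shift k)"
proof (rule injI)
  fix x y assume "shift k x = shift k y"
  then show "x = y" by (cases x; cases y) auto
qed

lemma shift_shift: "shift k (shift l x) = shift (l + k) x"
  by (cases x) auto

lemma shift_0: "shift 0 = id"
proof
  fix x show "shift 0 x = id x" by (cases x) auto
qed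

lemma finite_vertices: "finite (vertices k)"
  by (simp add: vertices_def)

lemma vertices_mono: "k \<le> l \<Longrightarrow> vertices k \<subseteq> vertices l"
  by (auto simp: vertices_def)

lemma vertices_add: "vertices (k + l) = vertices k \<union> shift k ` vertices l"
proof (intro equalityI subsetI)
  fix x assume x: "x \<in> vertices (k + l)"
  show "x \<in> vertices k \<union> shift k ` vertices l"
  proof (cases x)
    case (Top i)
    show ?thesis
    proof (cases "i \<le> k")
      case False
      then have "x = shift k (Top (i - k))" "Top (i - k) \<in> vertices l"
        using x Top by (auto simp: vertices_def image_iff)
      then show ?thesis by blast
    qed (use x Top in \<open>auto simp: vertices_def\<close>)
  next
    case (Bot i)
    show ?thesis
    proof (cases "i \<le> k")
      case False
      then have "x = shift k (Bot (i - k))" "Bot (i - k) \<in> vertices l"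
        using x Bot by (auto simp: vertices_def image_iff)
      then show ?thesis by blast
    qed (use x Bot in \<open>auto simp: vertices_def\<close>)
  qed
qed (auto simp: vertices_def)

lemma vertices_shift_disjoint: "vertices k \<inter> shift k ` vertices l = {}"
  by (auto simp: vertices_def)

lemma partition_on_image:
  assumes "partition_on A P" "inj f"
  shows "partition_on (f ` A) ((`) f ` P)"
proof -
  have "partition_on (f ` A) ((`) f ` P - {{}})"
    using partition_on_inj_image[OF assms(1)] assms(2) by (meson inj_on_subset subset_UNIV)
  moreover have "{} \<notin> (`) f ` P"
    using assms(1) by (auto simp: partition_on_def)
  ultimately show ?thesis by simp
qed

lemma partition_on_shift_Un:
  assumes "partition_on (vertices k) P" "partition_on (vertices l) Q"
  shows "partition_on (vertices (k + l)) (P \<union> (`) (shift k) ` Q)"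
proof -
  have Q: "partition_on (shift k ` vertices l) ((`) (shift k) ` Q)"
    by (rule partition_on_image[OF assms(2) inj_shift])
  have "disjoint (P \<union> (`) (shift k) ` Q)"
    using vertices_shift_disjoint[of k l] partition_onD1[OF assms(1)] partition_onD1[OF Q]
    by (intro disjoint_union partition_onD2[OF assms(1)] partition_onD2[OF Q]) metis
  then show ?thesis
    using partition_onD1[OF assms(1)] partition_onD1[OF Q]
      partition_onD3[OF assms(1)] partition_onD3[OF Q]
    unfolding vertices_add partition_on_def by simp
qed

text \<open>The product $\otimes$ of diagrams is written additively and the empty diagram is \<open>0\<close>, so
  that the ring structure of \<^typ>\<open>'a \<Rightarrow>\<^sub>0 'b\<close> is that of the monoid algebra of diagrams.\<close>

instantiation diagram :: monoid_add
begin

lift_definition zero_diagram :: diagram is "(0, {})"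
  by (simp add: vertices_def partition_on_def)

lift_definition plus_diagram :: "diagram \<Rightarrow> diagram \<Rightarrow> diagram"
  is "\<lambda>(k, P) (l, Q). (k + l, P \<union> (`) (shift k) ` Q)"
  using partition_on_shift_Un by auto

instance
proof
  fix a b c :: diagram
  show "0 + a = a" by transfer (auto simp: shift_0)
  show "a + 0 = a" by transfer auto
  show "a + b + c = a + (b + c)"
    by transfer (auto simp: image_Un image_image shift_shift Un_assoc add.assoc add.commute)
qed

end

lemma diagram_order_0 [simp]: "diagram_order 0 = 0"
  by transfer simp

lemma diagram_order_add [simp]: "diagram_order (\<pi> + \<rho>) = diagram_order \<pi> + diagram_order \<rho>"
  by transfer auto

lemma blocks_add: "blocks (\<pi> + \<rho>) = blocks \<pi> \<union> (`) (shift (diagram_order \<pi>)) ` blocks \<rho>"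
  by transfer auto

lemma diagram_order_eq_0_iff: "diagram_order \<pi> = 0 \<longleftrightarrow> \<pi> = 0"
  by transfer (auto simp: vertices_def partition_on_def)

text \<open>Literally as in the definition of $\otimes$-irreducibility, \<open>0\<close> qualifies as well; it
  is excluded wherever nonempty diagrams are meant.\<close>

definition tensor_irreducible :: "diagram \<Rightarrow> bool" where
  "tensor_irreducible \<pi> \<longleftrightarrow> \<not> (\<exists>\<rho>\<^sub>1 \<rho>\<^sub>2. \<rho>\<^sub>1 \<noteq> 0 \<and> \<rho>\<^sub>2 \<noteq> 0 \<and> \<pi> = \<rho>\<^sub>1 + \<rho>\<^sub>2)"

text \<open>Unites the blocks of \<open>u\<close> and \<open>v\<close>. Removing the empty set only has an effect when neither
  is a vertex of the diagram.\<close>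

lift_definition merge_blocks :: "vertex \<Rightarrow> vertex \<Rightarrow> diagram \<Rightarrow> diagram"
  is "\<lambda>u v (k, P). (k, {B \<in> P. u \<notin> B \<and> v \<notin> B} \<union> ({\<Union>{B \<in> P. u \<in> B \<or> v \<in> B}} - {{}}))"
proof -
  fix u v :: vertex and p :: "nat \<times> vertex set set"
  obtain k P where p: "p = (k, P)" by fastforce
  assume "p \<in> {(k, P). partition_on (vertices k) P}"
  then have P: "partition_on (vertices k) P" by (simp add: p)
  let ?A = "{B \<in> P. u \<notin> B \<and> v \<notin> B}" and ?U = "\<Union>{B \<in> P. u \<in> B \<or> v \<in> B}"
  have 1: "\<Union>(?A \<union> ({?U} - {{}})) = vertices k"
    unfolding partition_onD1[OF P] by auto
  have 2: "disjoint ?A" using partition_onD2[OF P] by (auto simp: pairwise_def)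
  have 3: "\<Union>?A \<inter> \<Union>({?U} - {{}}) = {}"
    using partition_onD2[OF P] unfolding disjoint_def by blast
  have "disjoint (?A \<union> ({?U} - {{}}))"
    by (rule disjoint_union[OF 2 _ 3]) (auto simp: disjoint_def)
  then have "partition_on (vertices k) (?A \<union> ({?U} - {{}}))"
    using 1 partition_onD3[OF P] unfolding partition_on_def by blast
  then show "(case p of (k, P) \<Rightarrow> (k, {B \<in> P. u \<notin> B \<and> v \<notin> B} \<union>
      ({\<Union>{B \<in> P. u \<in> B \<or> v \<in> B}} - {{}}))) \<in> {(k, P). partition_on (vertices k) P}"
    by (simp add: p)
qed

definition bullet :: "diagram \<Rightarrow> diagram \<Rightarrow> diagram" (infixr \<open>\<bullet>\<^sub>D\<close> 65) where
  "\<pi> \<bullet>\<^sub>D \<rho> = (if \<pi> = 0 then \<rho> else if \<rho> = 0 then \<pi>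
     else merge_blocks (Bot (diagram_order \<pi>)) (Bot (diagram_order \<pi> + 1)) (\<pi> + \<rho>))"

lemma diagram_order_bullet: "diagram_order (\<pi> \<bullet>\<^sub>D \<rho>) = diagram_order \<pi> + diagram_order \<rho>"
proof -
  have "diagram_order (merge_blocks u v \<sigma>) = diagram_order \<sigma>" for u v \<sigma>
    by transfer auto
  then show ?thesis by (auto simp: bullet_def)
qed


section \<open>Planarity\<close>

text \<open>A graph on a vertex set \<open>V\<close> is given by its set of edges, which are two-element subsets of
  \<open>V\<close>.\<close>

definition graph_components :: "'a set \<Rightarrow> 'a set set \<Rightarrow> 'a set set" where
  "graph_components V E = V // {(u, v). u \<in> V \<and> v \<in> V \<and> (u, v) \<in> {(x, y). {x, y} \<in> E}\<^sup>*}"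

definition vertex_position :: "vertex \<Rightarrow> real ^ 2" where
  "vertex_position u = (case u of Top i \<Rightarrow> vector [real i, 1] | Bot i \<Rightarrow> vector [real i, 0])"

definition rectangle :: "nat \<Rightarrow> (real ^ 2) set" where
  "rectangle k = cbox (vector [1, 0]) (vector [real k, 1])"

text \<open>\<open>\<gamma> e\<close> is the curve representing the edge \<open>e\<close>.\<close>

definition crossing_free_drawing ::
    "nat \<Rightarrow> vertex set set \<Rightarrow> (vertex set \<Rightarrow> real \<Rightarrow> real ^ 2) \<Rightarrow> bool" where
  "crossing_free_drawing k E \<gamma> \<longleftrightarrow>
     (\<forall>e\<in>E. arc (\<gamma> e) \<and> {pathstart (\<gamma> e), pathfinish (\<gamma> e)} = vertex_position ` e \<and>
        path_image (\<gamma> e) \<subseteq> rectangle k \<and>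
        path_image (\<gamma> e) \<inter> vertex_position ` vertices k \<subseteq> vertex_position ` e) \<and>
     (\<forall>e\<in>E. \<forall>f\<in>E. e \<noteq> f \<longrightarrow>
        path_image (\<gamma> e) \<inter> path_image (\<gamma> f) \<subseteq> vertex_position ` (e \<inter> f))"

definition planar :: "diagram \<Rightarrow> bool" where
  "planar \<pi> \<longleftrightarrow> (\<exists>E \<gamma>.
     E \<subseteq> {{u, v} |u v. u \<in> vertices (diagram_order \<pi>) \<and> v \<in> vertices (diagram_order \<pi>) \<and> u \<noteq> v} \<and>
     graph_components (vertices (diagram_order \<pi>)) E = blocks \<pi> \<and>
     crossing_free_drawing (diagram_order \<pi>) E \<gamma>)"


section \<open>The Hopf algebra of partition diagrams\<close>

definition scalar_mult :: "'k::field \<Rightarrow> ('a \<Rightarrow>\<^sub>0 'k) \<Rightarrow> ('a \<Rightarrow>\<^sub>0 'k)" where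
  "scalar_mult c p = Poly_Mapping.map ((*) c) p"

lemma lookup_scalar_mult: "Poly_Mapping.lookup (scalar_mult c p) x = c * Poly_Mapping.lookup p x"
  unfolding scalar_mult_def by transfer (simp add: when_def)

global_interpretation free_module: vector_space "scalar_mult :: 'k::field \<Rightarrow> ('a \<Rightarrow>\<^sub>0 'k) \<Rightarrow> ('a \<Rightarrow>\<^sub>0 'k)"
  by unfold_locales
    (auto intro!: poly_mapping_eqI simp: lookup_scalar_mult lookup_add algebra_simps)

text \<open>The unit is $\textsf{H}_\varnothing$. The tensor square is realised on its basis
  $\textsf{H}_\pi \otimes \textsf{H}_\rho$, indexed by pairs of diagrams; its ring structure is
  the monoid algebra of the product monoid, so multiplication is componentwise.\<close>

type_synonym 'k parsym = "diagram \<Rightarrow>\<^sub>0 'k"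
type_synonym 'k parsym2 = "diagram \<times> diagram \<Rightarrow>\<^sub>0 'k"

definition H :: "diagram \<Rightarrow> 'k::field parsym" where
  "H \<pi> = Poly_Mapping.single \<pi> 1"

definition tensor :: "'k::field parsym \<Rightarrow> 'k parsym \<Rightarrow> 'k parsym2" where
  "tensor a b = (\<Sum>\<pi>\<in>Poly_Mapping.keys a. \<Sum>\<rho>\<in>Poly_Mapping.keys b.
     Poly_Mapping.single (\<pi>, \<rho>) (Poly_Mapping.lookup a \<pi> * Poly_Mapping.lookup b \<rho>))"

definition tensor_square :: "'k::field parsym set \<Rightarrow> 'k parsym2 set" where
  "tensor_square W = free_module.span {tensor a b |a b. a \<in> W \<and> b \<in> W}"

definition comult_spec :: "('k::field parsym \<Rightarrow> 'k parsym2) \<Rightarrow> bool" where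
  "comult_spec D \<longleftrightarrow>
     Vector_Spaces.linear scalar_mult scalar_mult D \<and>
     D (H 0) = tensor (H 0) (H 0) \<and>
     (\<forall>a b. D (a * b) = D a * D b) \<and>
     (\<forall>\<pi>. \<pi> \<noteq> 0 \<and> tensor_irreducible \<pi> \<longrightarrow>
        D (H \<pi>) = (\<Sum>(G\<^sub>1, G\<^sub>2) \<in> {(G\<^sub>1, G\<^sub>2). (G\<^sub>1 = 0 \<or> tensor_irreducible G\<^sub>1) \<and>
            (G\<^sub>2 = 0 \<or> tensor_irreducible G\<^sub>2) \<and> G\<^sub>1 \<bullet>\<^sub>D G\<^sub>2 = \<pi>}. tensor (H G\<^sub>1) (H G\<^sub>2)))"

definition antipode_spec :: "('k::field parsym \<Rightarrow> 'k parsym) \<Rightarrow> bool" where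
  "antipode_spec S \<longleftrightarrow>
     Vector_Spaces.linear scalar_mult scalar_mult S \<and>
     S (H 0) = H 0 \<and>
     (\<forall>a b. S (a * b) = S b * S a) \<and>
     (\<forall>\<pi>. \<pi> \<noteq> 0 \<and> tensor_irreducible \<pi> \<longrightarrow>
        S (H \<pi>) = (\<Sum>\<rho>s \<in> {\<rho>s. 0 \<notin> set \<rho>s \<and> foldr (\<bullet>\<^sub>D) \<rho>s 0 = \<pi>}.
          scalar_mult ((- 1) ^ length \<rho>s) (prod_list (map H \<rho>s))))"

text \<open>Existence and uniqueness of the two maps follow from ParSym being free on the nonempty
  $\otimes$-irreducible diagrams, and the two sums are finite; all of this is established
  below.\<close>

definition comult :: "'k::field parsym \<Rightarrow> 'k parsym2" where
  "comult = (THE D. comult_spec D)"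

definition antipode :: "'k::field parsym \<Rightarrow> 'k parsym" where
  "antipode = (THE S. antipode_spec S)"

definition hopf_subalgebra :: "'k::field parsym set \<Rightarrow> bool" where
  "hopf_subalgebra W \<longleftrightarrow>
     free_module.subspace W \<and>
     H 0 \<in> W \<and>
     (\<forall>a\<in>W. \<forall>b\<in>W. a * b \<in> W) \<and>
     comult ` W \<subseteq> tensor_square W \<and>
     antipode ` W \<subseteq> W"


section \<open>The index sets are finite\<close>

lemma finite_diagrams: "finite {\<pi>. diagram_order \<pi> \<le> n}"
proof -
  let ?f = "\<lambda>\<pi>. (diagram_order \<pi>, blocks \<pi>)"
  have "blocks \<pi> \<in> Pow (Pow (vertices n))" if "diagram_order \<pi> \<le> n" for \<pi>
    using partition_onD1[OF partition_on_blocks[of \<pi>]] vertices_mono[OF that] by auto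
  then have "?f ` {\<pi>. diagram_order \<pi> \<le> n} \<subseteq> {..n} \<times> Pow (Pow (vertices n))"
    by auto
  moreover have "finite ({..n} \<times> Pow (Pow (vertices n)))"
    by (simp add: finite_vertices)
  moreover have "inj_on ?f {\<pi>. diagram_order \<pi> \<le> n}"
    by (auto intro!: inj_onI diagram_eqI)
  ultimately show ?thesis using finite_imageD finite_subset by blast
qed

lemma finite_comult_pairs:
  "finite {(G\<^sub>1, G\<^sub>2). (G\<^sub>1 = 0 \<or> tensor_irreducible G\<^sub>1) \<and>
     (G\<^sub>2 = 0 \<or> tensor_irreducible G\<^sub>2) \<and> G\<^sub>1 \<bullet>\<^sub>D G\<^sub>2 = \<pi>}"
  by (rule finite_subset[of _ "{\<sigma>. diagram_order \<sigma> \<le> diagram_order \<pi>} \<times>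
        {\<sigma>. diagram_order \<sigma> \<le> diagram_order \<pi>}"])
    (auto simp: finite_diagrams diagram_order_bullet)

lemma finite_antipode_tuples: "finite {\<rho>s. 0 \<notin> set \<rho>s \<and> foldr (\<bullet>\<^sub>D) \<rho>s 0 = \<pi>}"
proof -
  have len: "0 \<notin> set \<rho>s \<Longrightarrow> length \<rho>s \<le> diagram_order (foldr (\<bullet>\<^sub>D) \<rho>s 0)" for \<rho>s
  proof (induction \<rho>s)
    case (Cons \<rho> \<rho>s)
    then have "diagram_order \<rho> \<noteq> 0" by (auto simp: diagram_order_eq_0_iff)
    with Cons show ?case by (auto simp: diagram_order_bullet)
  qed simp
  have ord: "\<rho> \<in> set \<rho>s \<Longrightarrow> diagram_order \<rho> \<le> diagram_order (foldr (\<bullet>\<^sub>D) \<rho>s 0)" for \<rho> \<rho>s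
    by (induction \<rho>s) (auto simp: diagram_order_bullet)
  show ?thesis
    by (rule finite_subset[OF _ finite_lists_length_le[OF finite_diagrams[of "diagram_order \<pi>"],
            of "diagram_order \<pi>"]])
      (use len ord in auto)
qed


section \<open>Existence and uniqueness of the comultiplication and the antipode\<close>

lemma disjoint_families:
  assumes "\<Union>A \<inter> \<Union>B = {}" "{} \<notin> A"
  shows "A \<inter> B = {}"
proof (rule equals0I)
  fix X assume X: "X \<in> A \<inter> B"
  have "X \<noteq> {}"
  proof
    assume "X = {}"
    then show False using X assms(2) by simp
  qed
  then obtain x where "x \<in> X" by (auto simp only: ex_in_conv[symmetric])
  then have "x \<in> \<Union>A \<inter> \<Union>B" using X by auto
  then show False using assms(1) by simp
qed

lemma diagram_levi:
  assumes eq: "a + b = c + d" and le: "diagram_order a \<le> diagram_order c"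
  obtains e where "c = a + e" "b = e + d"
proof -
  define k m where "k = diagram_order a" and "m = diagram_order c - diagram_order a"
  have c: "diagram_order c = k + m" using le by (simp add: k_def m_def)
  have bd: "diagram_order b = m + diagram_order d"
    using arg_cong[OF eq, of diagram_order] c by (simp add: k_def)
  have inj: "inj ((`) (shift k))" by (intro injI) (simp add: inj_image_eq_iff[OF inj_shift])
  have eqB: "blocks a \<union> (`) (shift k) ` blocks b =
      blocks c \<union> (`) (shift (k + m)) ` blocks d"
    using arg_cong[OF eq, of blocks] c by (simp add: blocks_add k_def)
  have Pa: "partition_on (vertices k) (blocks a)"
    and Pc: "partition_on (vertices k \<union> shift k ` vertices m) (blocks c)"
    and Pd: "partition_on (vertices (diagram_order d)) (blocks d)"
    using partition_on_blocks[of a] partition_on_blocks[of c] partition_on_blocks[of d] c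
    by (auto simp: k_def vertices_add)
  define E where "E = {B \<in> blocks b. shift k ` B \<in> blocks c}"
  have Ub: "\<Union>((`) (shift k) ` blocks b) = shift k ` vertices (diagram_order b)"
    using partition_onD1[OF partition_on_image[OF partition_on_blocks[of b] inj_shift]] by simp
  have Ua: "\<Union>(blocks a) = vertices k"
    by (rule partition_onD1[OF Pa, symmetric])
  have disj_ab: "blocks a \<inter> (`) (shift k) ` blocks b = {}"
  proof -
    have "\<Union>(blocks a) \<inter> \<Union>((`) (shift k) ` blocks b) = {}"
      by (simp only: Ua Ub vertices_shift_disjoint)
    then show ?thesis using partition_onD3[OF Pa] by (rule disjoint_families)
  qed
  have disj_ad: "blocks a \<inter> (`) (shift (k + m)) ` blocks d = {}"
  proof -
    have "\<Union>((`) (shift (k + m)) ` blocks d) = shift (k + m) ` vertices (diagram_order d)"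
      using partition_onD1[OF partition_on_image[OF Pd inj_shift]] by simp
    moreover have "\<Union>(blocks a) \<subseteq> vertices (k + m)"
      by (simp only: Ua vertices_mono le_add1)
    ultimately have "\<Union>(blocks a) \<inter> \<Union>((`) (shift (k + m)) ` blocks d) = {}"
      using vertices_shift_disjoint[of "k + m" "diagram_order d"] by blast
    then show ?thesis using partition_onD3[OF Pa] by (rule disjoint_families)
  qed
  have ac: "B \<in> blocks c" if B: "B \<in> blocks a" for B
  proof -
    have "B \<in> blocks c \<union> (`) (shift (k + m)) ` blocks d" using B eqB by blast
    then show ?thesis using B disj_ad by blast
  qed
  have cE: "blocks c = blocks a \<union> (`) (shift k) ` E"
  proof (intro equalityI subsetI)
    fix B assume B: "B \<in> blocks c"
    then have "B \<in> blocks a \<union> (`) (shift k) ` blocks b" using eqB by simp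
    then show "B \<in> blocks a \<union> (`) (shift k) ` E" using B by (auto simp: E_def)
  qed (use ac in \<open>auto simp: E_def\<close>)
  have disjE: "blocks a \<inter> (`) (shift k) ` E = {}"
    using disj_ab unfolding E_def by blast
  have sub: "(\<Union>E) \<subseteq> vertices m"
  proof
    fix x assume "x \<in> \<Union>E"
    then obtain B where B: "B \<in> E" "x \<in> B" by auto
    then have "shift k x \<in> vertices k \<union> shift k ` vertices m"
      using partition_onD1[OF Pc] by (auto simp: E_def)
    moreover have "x \<in> vertices (diagram_order b)"
      using B partition_onD1[OF partition_on_blocks[of b]] by (auto simp: E_def)
    then have "shift k x \<notin> vertices k"
      using vertices_shift_disjoint[of k "diagram_order b"] by auto
    ultimately show "x \<in> vertices m" using inj_shift[of k] by (auto simp: inj_eq)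
  qed
  have sup: "vertices m \<subseteq> \<Union>E"
  proof
    fix x assume "x \<in> vertices m"
    then have "shift k x \<in> \<Union>(blocks c)" "shift k x \<notin> \<Union>(blocks a)"
      using partition_onD1[OF Pc] partition_onD1[OF Pa] vertices_shift_disjoint[of k m] by auto
    then have "shift k x \<in> \<Union>((`) (shift k) ` E)" using cE by auto
    then show "x \<in> \<Union>E" using inj_shift[of k] by (auto simp: inj_eq)
  qed
  have "partition_on (vertices m) E"
    using sub sup partition_onD2[OF partition_on_blocks[of b]]
      partition_onD3[OF partition_on_blocks[of b]]
    by (auto simp: partition_on_def E_def pairwise_def)
  then obtain e where e: "diagram_order e = m" "blocks e = E" by (rule diagram_exists)
  have 1: "c = a + e"
    by (rule diagram_eqI) (simp_all add: c e blocks_add cE flip: k_def)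
  have "(`) (shift k) ` blocks b = (`) (shift k) ` (E \<union> (`) (shift m) ` blocks d)"
  proof -
    have s: "(`) (shift k) ` (`) (shift m) ` blocks d = (`) (shift (k + m)) ` blocks d"
      by (simp add: image_image shift_shift add.commute)
    have gen: "B = E' \<union> D"
      if "A \<union> B = A \<union> E' \<union> D" "A \<inter> E' = {}" "A \<inter> B = {}" "A \<inter> D = {}"
      for A B D E' :: "vertex set set"
    proof -
      have "B = (A \<union> B) - A" using that(3) by auto
      also have "\<dots> = (A \<union> E' \<union> D) - A" using that(1) by simp
      also have "\<dots> = E' \<union> D" using that(2,4) by auto
      finally show ?thesis .
    qed
    show ?thesis
      unfolding image_Un s
      by (rule gen[OF _ disjE disj_ab disj_ad]) (use eqB cE in simp)
  qed
  then have "blocks b = E \<union> (`) (shift m) ` blocks d"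
    by (rule inj_image_eq_iff[OF inj, THEN iffD1])
  then have 2: "b = e + d"
    by (intro diagram_eqI) (simp_all add: bd e blocks_add)
  show ?thesis using that 1 2 by blast
qed

definition irreducible_factors :: "diagram list \<Rightarrow> bool" where
  "irreducible_factors \<pi>s \<longleftrightarrow> (\<forall>\<pi>\<in>set \<pi>s. \<pi> \<noteq> 0 \<and> tensor_irreducible \<pi>)"

lemma factorization_exists: "\<exists>\<pi>s. irreducible_factors \<pi>s \<and> sum_list \<pi>s = \<pi>"
proof (induction "diagram_order \<pi>" arbitrary: \<pi> rule: less_induct)
  case less
  consider "\<pi> = 0" | "\<pi> \<noteq> 0" "tensor_irreducible \<pi>"
    | a b where "a \<noteq> 0" "b \<noteq> 0" "\<pi> = a + b"
    unfolding tensor_irreducible_def by blast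
  then show ?case
  proof cases
    case 1
    then show ?thesis by (intro exI[of _ "[]"]) (simp add: irreducible_factors_def)
  next
    case 2
    then show ?thesis by (intro exI[of _ "[\<pi>]"]) (simp add: irreducible_factors_def)
  next
    case 3
    then have "diagram_order a < diagram_order \<pi>" "diagram_order b < diagram_order \<pi>"
      using diagram_order_eq_0_iff[of a] diagram_order_eq_0_iff[of b] by auto
    then obtain as bs where "irreducible_factors as" "sum_list as = a"
      "irreducible_factors bs" "sum_list bs = b" using less[of a] less[of b] by blast
    then have "irreducible_factors (as @ bs) \<and> sum_list (as @ bs) = \<pi>"
      using 3(3) by (auto simp: irreducible_factors_def)
    then show ?thesis by blast
  qed
qed

lemma tensor_irreducible_addD: "tensor_irreducible (a + b) \<Longrightarrow> a \<noteq> 0 \<Longrightarrow> b = 0"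
  unfolding tensor_irreducible_def by blast

lemma diagram_add_eq_0D: "a + b = 0 \<Longrightarrow> a = (0 :: diagram)"
  using diagram_order_add[of a b] diagram_order_eq_0_iff[of a] by simp

lemma factorization_unique:
  assumes "irreducible_factors xs" "irreducible_factors ys" "sum_list xs = sum_list ys"
  shows "xs = ys"
  using assms
proof (induction xs arbitrary: ys)
  case Nil
  show ?case
  proof (cases ys)
    case (Cons y ys')
    have "y + sum_list ys' = 0" using Nil(3) unfolding Cons by simp
    then have "y = 0" by (rule diagram_add_eq_0D)
    then show ?thesis using Nil(2) unfolding Cons irreducible_factors_def by simp
  qed simp
next
  case (Cons x xs)
  show ?case
  proof (cases ys)
    case Nil
    have "x + sum_list xs = 0" using Cons.prems(3) unfolding Nil by simp
    then have "x = 0" by (rule diagram_add_eq_0D)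
    then show ?thesis using Cons.prems(1) unfolding irreducible_factors_def by simp
  next
    case (Cons y ys')
    have xy: "x \<noteq> 0" "y \<noteq> 0" "tensor_irreducible x" "tensor_irreducible y"
      using Cons.prems(1,2) unfolding Cons irreducible_factors_def by simp_all
    have eq: "x + sum_list xs = y + sum_list ys'"
      using Cons.prems(3) unfolding Cons by simp
    have "x = y \<and> sum_list xs = sum_list ys'"
    proof (cases "diagram_order x \<le> diagram_order y")
      case True
      obtain e where e: "y = x + e" "sum_list xs = e + sum_list ys'"
        by (rule diagram_levi[OF eq True])
      have "e = 0" using xy(1,4) unfolding e(1) by (metis tensor_irreducible_addD)
      with e show ?thesis by simp
    next
      case False
      then have "diagram_order y \<le> diagram_order x" by simp
      from diagram_levi[OF eq[symmetric] this]
      obtain e where e: "x = y + e" "sum_list ys' = e + sum_list xs" .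
      have "e = 0" using xy(2,3) unfolding e(1) by (metis tensor_irreducible_addD)
      with e show ?thesis by simp
    qed
    moreover have "irreducible_factors xs" "irreducible_factors ys'"
      using Cons.prems(1,2) unfolding Cons irreducible_factors_def by simp_all
    ultimately show ?thesis using Cons.IH Cons by blast
  qed
qed

definition factors :: "diagram \<Rightarrow> diagram list" where
  "factors \<pi> = (SOME \<pi>s. irreducible_factors \<pi>s \<and> sum_list \<pi>s = \<pi>)"

lemma factors: "irreducible_factors (factors \<pi>)" "sum_list (factors \<pi>) = \<pi>"
  using someI_ex[OF factorization_exists[of \<pi>]] by (auto simp: factors_def)

lemma factors_eqI: "irreducible_factors \<pi>s \<Longrightarrow> sum_list \<pi>s = \<pi> \<Longrightarrow> factors \<pi> = \<pi>s"
  using factorization_unique factors by metis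

lemma factors_0: "factors 0 = []"
  by (rule factors_eqI) (auto simp: irreducible_factors_def)

lemma factors_irreducible: "\<pi> \<noteq> 0 \<Longrightarrow> tensor_irreducible \<pi> \<Longrightarrow> factors \<pi> = [\<pi>]"
  by (rule factors_eqI) (auto simp: irreducible_factors_def)

lemma factors_add: "factors (\<pi> + \<rho>) = factors \<pi> @ factors \<rho>"
  by (rule factors_eqI)
    (use factors[of \<pi>] factors[of \<rho>] in \<open>auto simp: irreducible_factors_def\<close>)

definition linear_extension :: "('a \<Rightarrow> 'b \<Rightarrow>\<^sub>0 'k::field) \<Rightarrow> ('a \<Rightarrow>\<^sub>0 'k) \<Rightarrow> ('b \<Rightarrow>\<^sub>0 'k)" where
  "linear_extension h p = (\<Sum>x\<in>Poly_Mapping.keys p. scalar_mult (Poly_Mapping.lookup p x) (h x))"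

lemma linear_extension_superset:
  assumes "finite A" "Poly_Mapping.keys p \<subseteq> A"
  shows "linear_extension h p = (\<Sum>x\<in>A. scalar_mult (Poly_Mapping.lookup p x) (h x))"
  unfolding linear_extension_def
  by (rule sum.mono_neutral_left) (use assms in \<open>auto simp: in_keys_iff\<close>)

lemma linear_scaleI:
  assumes "\<And>p q. f (p + q) = f p + f q" "\<And>c p. f (scalar_mult c p) = scalar_mult c (f p)"
  shows "Vector_Spaces.linear scalar_mult scalar_mult f"
  unfolding Vector_Spaces.linear_iff
  by (intro conjI allI free_module.vector_space_axioms assms)

lemma linear_linear_extension:
  fixes h :: "'a \<Rightarrow> 'b \<Rightarrow>\<^sub>0 'k::field"
  shows "Vector_Spaces.linear scalar_mult scalar_mult (linear_extension h)"
proof (rule linear_scaleI)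
  fix p q :: "'a \<Rightarrow>\<^sub>0 'k"
  let ?A = "Poly_Mapping.keys p \<union> Poly_Mapping.keys q"
  have "finite ?A" by simp
  then have ext: "Poly_Mapping.keys r \<subseteq> ?A \<Longrightarrow>
      linear_extension h r = (\<Sum>x\<in>?A. scalar_mult (Poly_Mapping.lookup r x) (h x))" for r
    by (rule linear_extension_superset)
  show "linear_extension h (p + q) = linear_extension h p + linear_extension h q"
    by (simp add: ext keys_add lookup_add free_module.scale_left_distrib sum.distrib)
next
  fix c and p :: "'a \<Rightarrow>\<^sub>0 'k"
  have "Poly_Mapping.keys (scalar_mult c p) \<subseteq> Poly_Mapping.keys p"
    by (auto simp: in_keys_iff lookup_scalar_mult)
  then have "linear_extension h (scalar_mult c p) =
      (\<Sum>x\<in>Poly_Mapping.keys p. scalar_mult (Poly_Mapping.lookup (scalar_mult c p) x) (h x))"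
    by (intro linear_extension_superset) auto
  then show "linear_extension h (scalar_mult c p) = scalar_mult c (linear_extension h p)"
    by (simp add: linear_extension_def lookup_scalar_mult free_module.scale_sum_right)
qed

lemma linear_extension_single: "linear_extension h (Poly_Mapping.single x 1) = h x"
  by (simp add: linear_extension_def)

lemma linear_eqI:
  fixes f g :: "('a \<Rightarrow>\<^sub>0 'k::field) \<Rightarrow> ('b \<Rightarrow>\<^sub>0 'k)"
  assumes f: "Vector_Spaces.linear scalar_mult scalar_mult f" and g: "Vector_Spaces.linear scalar_mult scalar_mult g"
    and eq: "\<And>x. f (Poly_Mapping.single x 1) = g (Poly_Mapping.single x 1)"
  shows "f = g"
proof
  fix p :: "'a \<Rightarrow>\<^sub>0 'k"
  have p: "p = (\<Sum>x\<in>Poly_Mapping.keys p.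
      scalar_mult (Poly_Mapping.lookup p x) (Poly_Mapping.single x 1))" (is "p = ?s")
  proof (rule poly_mapping_eqI)
    fix y
    show "Poly_Mapping.lookup p y = Poly_Mapping.lookup ?s y"
      by (simp add: lookup_sum lookup_scalar_mult lookup_single when_def in_keys_iff
          if_distrib[of "(*) _"] sum.delta cong: if_cong)
  qed
  interpret f: Vector_Spaces.linear scalar_mult scalar_mult f by (rule f)
  interpret g: Vector_Spaces.linear scalar_mult scalar_mult g by (rule g)
  have "f ?s = g ?s" by (simp add: f.sum g.sum f.scale g.scale eq)
  then show "f p = g p" using p by simp
qed

lemma scale_single: "scalar_mult c (Poly_Mapping.single x d) = Poly_Mapping.single x (c * d)"
  by (rule poly_mapping_eqI) (simp add: lookup_scalar_mult lookup_single when_def)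

lemma scale_mult_left: "scalar_mult c (p :: ('a::monoid_add) \<Rightarrow>\<^sub>0 'k::field) * q = scalar_mult c (p * q)"
  by (simp add: scalar_mult_def mult_map_scale_conv_mult mult.assoc)

lemma scale_mult_right: "(p :: ('a::monoid_add) \<Rightarrow>\<^sub>0 'k::field) * scalar_mult c q = scalar_mult c (p * q)"
proof -
  have "p * Poly_Mapping.single 0 c = Poly_Mapping.single 0 c * p"
  proof -
    have "Vector_Spaces.linear scalar_mult scalar_mult (\<lambda>p::'a \<Rightarrow>\<^sub>0 'k. p * Poly_Mapping.single 0 c)"
      by (rule linear_scaleI) (simp_all add: distrib_right scale_mult_left)
    moreover have "Vector_Spaces.linear scalar_mult scalar_mult (\<lambda>p::'a \<Rightarrow>\<^sub>0 'k. scalar_mult c p)"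
      by (rule linear_scaleI)
        (simp_all add: free_module.scale_right_distrib mult.commute)
    ultimately have "(\<lambda>p::'a \<Rightarrow>\<^sub>0 'k. p * Poly_Mapping.single 0 c) = (\<lambda>p. scalar_mult c p)"
      by (rule linear_eqI) (simp add: mult_single scale_single)
    then show ?thesis by (simp add: fun_eq_iff scalar_mult_def mult_map_scale_conv_mult)
  qed
  then show ?thesis by (simp add: scalar_mult_def mult_map_scale_conv_mult flip: mult.assoc)
qed

lemma bilinear_eqI:
  fixes f g :: "('a \<Rightarrow>\<^sub>0 'k::field) \<Rightarrow> ('a \<Rightarrow>\<^sub>0 'k) \<Rightarrow> ('b \<Rightarrow>\<^sub>0 'k)"
  assumes "\<And>p. Vector_Spaces.linear scalar_mult scalar_mult (f p)"
    and "\<And>p. Vector_Spaces.linear scalar_mult scalar_mult (g p)"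
    and "\<And>q. Vector_Spaces.linear scalar_mult scalar_mult (\<lambda>p. f p q)"
    and "\<And>q. Vector_Spaces.linear scalar_mult scalar_mult (\<lambda>p. g p q)"
    and eq: "\<And>x y. f (Poly_Mapping.single x 1) (Poly_Mapping.single y 1) =
      g (Poly_Mapping.single x 1) (Poly_Mapping.single y 1)"
  shows "f p q = g p q"
proof -
  have "f (Poly_Mapping.single x 1) = g (Poly_Mapping.single x 1)" for x
    by (rule linear_eqI) (use assms in auto)
  then have "(\<lambda>p. f p q) = (\<lambda>p. g p q)"
    by (intro linear_eqI) (use assms in auto)
  then show ?thesis by (rule fun_cong)
qed

lemma H_0: "H 0 = 1"
  by (simp add: H_def)

lemma H_add: "H (\<pi> + \<rho>) = H \<pi> * H \<rho>"
  by (simp add: H_def mult_single)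

lemma tensor_H: "tensor (H \<pi>) (H \<rho>) = Poly_Mapping.single (\<pi>, \<rho>) 1"
  by (simp add: tensor_def H_def)

lemma tensor_H_0: "tensor (H 0) (H 0) = 1"
  unfolding tensor_H zero_prod_def[symmetric] by simp

lemma ex1_multiplicative:
  fixes g :: "diagram \<Rightarrow> ('b::monoid_add \<Rightarrow>\<^sub>0 'k::field)"
    and mul :: "('b \<Rightarrow>\<^sub>0 'k) \<Rightarrow> ('b \<Rightarrow>\<^sub>0 'k) \<Rightarrow> ('b \<Rightarrow>\<^sub>0 'k)"
  assumes mul: "\<And>p. Vector_Spaces.linear scalar_mult scalar_mult (mul p)"
      "\<And>q. Vector_Spaces.linear scalar_mult scalar_mult (\<lambda>p. mul p q)"
    and assoc: "\<And>p q r. mul (mul p q) r = mul p (mul q r)"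
    and one: "\<And>p. mul 1 p = p" "\<And>p. mul p 1 = p"
  shows "\<exists>!D. Vector_Spaces.linear scalar_mult scalar_mult D \<and> D (H 0) = 1 \<and>
    (\<forall>a b. D (a * b) = mul (D a) (D b)) \<and>
    (\<forall>\<pi>. \<pi> \<noteq> 0 \<and> tensor_irreducible \<pi> \<longrightarrow> D (H \<pi>) = g \<pi>)" (is "\<exists>!D. ?P D")
proof (rule ex_ex1I)
  define h where "h \<pi> = foldr (\<lambda>\<sigma>. mul (g \<sigma>)) (factors \<pi>) 1" for \<pi>
  have fold: "foldr (\<lambda>\<sigma>. mul (g \<sigma>)) (xs @ ys) 1 =
      mul (foldr (\<lambda>\<sigma>. mul (g \<sigma>)) xs 1) (foldr (\<lambda>\<sigma>. mul (g \<sigma>)) ys 1)" for xs ys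
    by (induction xs) (simp_all add: one assoc)
  let ?D = "linear_extension h"
  have lin: "Vector_Spaces.linear scalar_mult scalar_mult ?D" by (rule linear_linear_extension)
  interpret D: Vector_Spaces.linear scalar_mult scalar_mult ?D by (rule lin)
  interpret m1: Vector_Spaces.linear scalar_mult scalar_mult "mul p" for p by (rule mul(1))
  interpret m2: Vector_Spaces.linear scalar_mult scalar_mult "\<lambda>p. mul p q" for q by (rule mul(2))
  have D: "?D (H \<pi>) = h \<pi>" for \<pi>
    by (simp add: H_def linear_extension_single)
  have "?D (a * b) = mul (?D a) (?D b)" for a b
    by (rule bilinear_eqI[where f = "\<lambda>a b. ?D (a * b)" and g = "\<lambda>a b. mul (?D a) (?D b)"];
        (rule linear_scaleI)?)
      (simp_all add: D distrib_left distrib_right scale_mult_left scale_mult_right D.add D.scale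
        m1.add m1.scale m2.add m2.scale mult_single linear_extension_single h_def factors_add fold
        del: foldr_append)
  moreover have "?D (H 0) = 1" by (simp add: D h_def factors_0)
  moreover have "?D (H \<pi>) = g \<pi>" if "\<pi> \<noteq> 0" "tensor_irreducible \<pi>" for \<pi>
    using factors_irreducible[OF that] by (simp add: D h_def one)
  ultimately show "\<exists>D. ?P D" using lin by blast
next
  fix D D' assume D: "?P D" and D': "?P D'"
  have "D (H (sum_list \<pi>s)) = D' (H (sum_list \<pi>s))" if "irreducible_factors \<pi>s" for \<pi>s
    using that
  proof (induction \<pi>s)
    case Nil
    then show ?case using D D' by simp
  next
    case (Cons \<pi> \<pi>s)
    then have "D (H \<pi>) = D' (H \<pi>)" "D (H (sum_list \<pi>s)) = D' (H (sum_list \<pi>s))"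
      using D D' by (auto simp: irreducible_factors_def)
    then show ?case using D D' by (simp add: H_add)
  qed
  then have "D (H \<pi>) = D' (H \<pi>)" for \<pi>
    using factors[of \<pi>] by metis
  then show "D = D'"
    using D D' by (intro linear_eqI) (auto simp: H_def)
qed

theorem comult_spec_ex1: "\<exists>!D. comult_spec (D :: 'k::field parsym \<Rightarrow> 'k parsym2)"
  unfolding comult_spec_def tensor_H_0
  by (rule ex1_multiplicative)
    (auto intro!: linear_scaleI
      simp: distrib_left distrib_right scale_mult_left scale_mult_right mult.assoc)

theorem antipode_spec_ex1: "\<exists>!S. antipode_spec (S :: 'k::field parsym \<Rightarrow> 'k parsym)"
proof -
  define g :: "diagram \<Rightarrow> 'k parsym" where
    "g \<pi> = (\<Sum>\<rho>s \<in> {\<rho>s. 0 \<notin> set \<rho>s \<and> foldr (\<bullet>\<^sub>D) \<rho>s 0 = \<pi>}.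
      scalar_mult ((- 1) ^ length \<rho>s) (prod_list (map H \<rho>s)))" for \<pi>
  have "\<exists>!S :: 'k parsym \<Rightarrow> 'k parsym. Vector_Spaces.linear scalar_mult scalar_mult S \<and> S (H 0) = 1 \<and>
      (\<forall>a b. S (a * b) = S b * S a) \<and>
      (\<forall>\<pi>. \<pi> \<noteq> 0 \<and> tensor_irreducible \<pi> \<longrightarrow> S (H \<pi>) = g \<pi>)"
    by (rule ex1_multiplicative[where mul = "\<lambda>a b. b * a"])
      (auto intro!: linear_scaleI
        simp: distrib_left distrib_right scale_mult_left scale_mult_right mult.assoc)
  then show ?thesis by (simp only: antipode_spec_def g_def H_0)
qed

lemma comult_spec: "comult_spec comult"
  unfolding comult_def by (rule theI'[OF comult_spec_ex1])

lemma antipode_spec: "antipode_spec antipode"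
  unfolding antipode_def by (rule theI'[OF antipode_spec_ex1])

end

theory Submission
  imports Defs
begin

text \<open>Walk around the boundary of the rectangle, from left to right along the top row and back
  along the bottom row. A diagram is planar iff no two of its blocks interlace in this order. If
  two blocks of a drawn diagram interlace, bending the rectangle into a half annulus puts all
  vertices on a line, and Fashoda's theorem makes the two blocks meet. Conversely, joining
  consecutive vertices of each block of a noncrossing diagram by explicit curves gives a drawing.
  The noncrossing property passes to and from $\otimes$-factors, and from $\pi \bullet \rho$ to
  $\pi$ and $\rho$, since distinct blocks of $\pi$ (or of $\rho$) lie in distinct blocks of
  $\pi \bullet \rho$. Hence all terms of the coproduct and of the antipode of a planar
  $\otimes$-irreducible diagram are planar, and multiplicativity does the rest.\<close>

section \<open>The boundary order and noncrossing families\<close>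

text \<open>Orders the vertices along the boundary: the top row from left to right, followed by the
  bottom row from right to left. Using reals independent of the order of the diagram makes the
  order invariant under \<open>shift\<close> and compatible with \<open>bend\<close> below.\<close>

primrec boundary_rank :: "vertex \<Rightarrow> real" where
  "boundary_rank (Top i) = - 1 / (real i + 1)"
| "boundary_rank (Bot i) = 1 / (real i + 1)"

lemma boundary_rank_less [simp]:
  "boundary_rank (Top i) < boundary_rank (Top j) \<longleftrightarrow> i < j"
  "boundary_rank (Top i) < boundary_rank (Bot j)"
  "\<not> boundary_rank (Bot i) < boundary_rank (Top j)"
  "boundary_rank (Bot i) < boundary_rank (Bot j) \<longleftrightarrow> j < i"
proof -
  have "0 < 1 / (real i + 1)" "0 < 1 / (real j + 1)" by simp_all
  then show "boundary_rank (Top i) < boundary_rank (Bot j)" "\<not> boundary_rank (Bot i) < boundary_rank (Top j)"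
    unfolding boundary_rank.simps minus_divide_left[symmetric] by linarith+
qed (auto simp: field_simps)

lemma inj_boundary_rank: "inj boundary_rank"
proof (rule injI)
  fix u v assume "boundary_rank u = boundary_rank v"
  then have "\<not> boundary_rank u < boundary_rank v" "\<not> boundary_rank v < boundary_rank u" by simp_all
  then show "u = v" by (cases u; cases v) (auto simp del: boundary_rank.simps)
qed

declare boundary_rank.simps [simp del]

lemma boundary_rank_shift_less [simp]: "boundary_rank (shift k u) < boundary_rank (shift k v) \<longleftrightarrow> boundary_rank u < boundary_rank v"
  by (cases u; cases v) simp_all

text \<open>Testing only the pattern in which \<open>B\<close> comes first suffices, since
  \<open>B\<close> and \<open>C\<close> range over all ordered pairs of members.\<close>

definition noncrossing :: "vertex set set \<Rightarrow> bool" where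
  "noncrossing P \<longleftrightarrow> (\<forall>B\<in>P. \<forall>C\<in>P. \<forall>a\<in>B. \<forall>b\<in>C. \<forall>c\<in>B. \<forall>d\<in>C.
     boundary_rank a < boundary_rank b \<longrightarrow> boundary_rank b < boundary_rank c \<longrightarrow> boundary_rank c < boundary_rank d \<longrightarrow> B = C)"

lemma noncrossingD:
  "noncrossing P \<Longrightarrow> B \<in> P \<Longrightarrow> C \<in> P \<Longrightarrow> a \<in> B \<Longrightarrow> b \<in> C \<Longrightarrow> c \<in> B \<Longrightarrow> d \<in> C \<Longrightarrow>
     boundary_rank a < boundary_rank b \<Longrightarrow> boundary_rank b < boundary_rank c \<Longrightarrow> boundary_rank c < boundary_rank d \<Longrightarrow> B = C"
  unfolding noncrossing_def by blast

section \<open>Planar diagrams are noncrossing\<close>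

lemma rectangle_iff: "z \<in> rectangle k \<longleftrightarrow> 1 \<le> z $ 1 \<and> z $ 1 \<le> real k \<and> 0 \<le> z $ 2 \<and> z $ 2 \<le> 1"
  by (auto simp: rectangle_def mem_box_cart forall_2)

lemma vec2_eq_iff: "(x :: real^2) = y \<longleftrightarrow> x $ 1 = y $ 1 \<and> x $ 2 = y $ 2"
  by (simp add: vec_eq_iff forall_2)

lemma vertex_position_nth [simp]:
  "vertex_position (Top i) $ 1 = real i" "vertex_position (Top i) $ 2 = 1"
  "vertex_position (Bot i) $ 1 = real i" "vertex_position (Bot i) $ 2 = 0"
  by (simp_all add: vertex_position_def)

lemma inj_vertex_position: "inj vertex_position"
proof (rule injI)
  fix u v assume "vertex_position u = vertex_position v"
  then show "u = v" by (cases u; cases v) (auto simp: vec2_eq_iff)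
qed

lemma vertex_position_eq_iff [simp]: "vertex_position u = vertex_position v \<longleftrightarrow> u = v"
  by (rule inj_eq[OF inj_vertex_position])

lemma vertex_position_in_rectangle: "u \<in> vertices k \<Longrightarrow> vertex_position u \<in> rectangle k"
  by (auto simp: vertices_def rectangle_iff)

lemma continuous_on_vector2:
  assumes "continuous_on S f" "continuous_on S g"
  shows "continuous_on S (\<lambda>x. vector [f x, g x] :: real^2)"
proof -
  have "(\<lambda>x. vector [f x, g x] :: real^2) = (\<lambda>x. \<chi> i. if i = 1 then f x else g x)"
    by (auto simp: fun_eq_iff vec_eq_iff forall_2)
  moreover have "continuous_on S (\<lambda>x. if i = 1 then f x else g x)" for i :: 2
    using assms by (cases "i = 1") simp_all
  ultimately show ?thesis by (simp only: continuous_on_vec_lambda)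
qed

text \<open>Bends the rectangle into a half annulus, so that all vertices come to lie on the real line,
  in the order of \<open>boundary_rank\<close>.\<close>

definition bend :: "real^2 \<Rightarrow> real^2" where
  "bend z = vector [cos (pi * z $ 2) / (z $ 1 + 1), sin (pi * z $ 2) / (z $ 1 + 1)]"

lemma bend_vertex_position: "bend (vertex_position u) = vector [boundary_rank u, 0]"
  by (cases u) (simp_all add: bend_def boundary_rank.simps)

lemma continuous_on_bend: "continuous_on (rectangle k) bend"
  unfolding bend_def
  by (intro continuous_on_vector2 continuous_intros) (auto simp: rectangle_iff)

text \<open>The squared norm of the image is the square of the positive number 1/(x + 1), so it
  determines the abscissa x. The first coordinate then determines the cosine, which is injective on
  [0, pi], and this gives the ordinate.\<close>

lemma inj_on_bend: "inj_on bend (rectangle k)"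
proof (rule inj_onI)
  fix z w assume z: "z \<in> rectangle k" and w: "w \<in> rectangle k" and eq: "bend z = bend w"
  have norm: "(bend v $ 1)\<^sup>2 + (bend v $ 2)\<^sup>2 = (1 / (v $ 1 + 1))\<^sup>2" for v
    unfolding bend_def by (simp add: power_divide flip: add_divide_distrib)
  have pos: "0 < z $ 1 + 1" "0 < w $ 1 + 1"
    using z w by (simp_all add: rectangle_iff)
  have "(1 / (z $ 1 + 1))\<^sup>2 = (1 / (w $ 1 + 1))\<^sup>2"
    using norm[of z] norm[of w] eq by simp
  then have "1 / (z $ 1 + 1) = 1 / (w $ 1 + 1)"
    by (rule power2_eq_imp_eq) (use pos in simp_all)
  then have 1: "z $ 1 = w $ 1" using pos by simp
  have "cos (pi * z $ 2) = cos (pi * w $ 2)"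
    using arg_cong[OF eq, of "\<lambda>v. v $ 1"] 1 pos by (simp add: bend_def)
  then have "pi * z $ 2 = pi * w $ 2"
    by (rule cos_inj_pi[rotated -1]) (use z w in \<open>auto simp: rectangle_iff\<close>)
  then show "z = w" using 1 by (simp add: vec2_eq_iff)
qed

text \<open>Provides the box for Fashoda's theorem, with the images of the vertices on its bottom
  side. The angle lies in [0, pi], so the sine is nonnegative, and the radius is at most 1.\<close>

lemma bend_in_box:
  assumes "z \<in> rectangle k"
  shows "bend z \<in> cbox (vector [- 1, 0]) (vector [1, 1])"
proof -
  have z: "1 \<le> z $ 1" "0 \<le> z $ 2" "z $ 2 \<le> 1" using assms by (simp_all add: rectangle_iff)
  have "0 \<le> sin (pi * z $ 2)"
    by (rule sin_ge_zero) (use z in auto)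
  moreover have "\<bar>cos (pi * z $ 2)\<bar> \<le> z $ 1 + 1"
    using abs_cos_le_one[of "pi * z $ 2"] z by linarith
  moreover have "sin (pi * z $ 2) \<le> z $ 1 + 1"
    using sin_le_one[of "pi * z $ 2"] z by linarith
  ultimately show ?thesis
    using z by (auto simp: mem_box_cart forall_2 bend_def divide_le_eq le_divide_eq abs_le_iff)
qed

text \<open>After bending, the four endpoints lie interlaced on the bottom side of a box that
  contains both curves, so \<open>fashoda_interlace\<close> gives a common point of the images.
  Injectivity of \<open>bend\<close> on the rectangle carries it back.\<close>

lemma interlaced_paths_meet:
  assumes "path f" "path_image f \<subseteq> rectangle k"
    and "pathstart f = vertex_position a" "pathfinish f = vertex_position c"
    and "path g" "path_image g \<subseteq> rectangle k"
    and "pathstart g = vertex_position b" "pathfinish g = vertex_position d"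
    and "boundary_rank a < boundary_rank b" "boundary_rank b < boundary_rank c" "boundary_rank c < boundary_rank d"
  shows "path_image f \<inter> path_image g \<noteq> {}"
proof -
  have "path (bend \<circ> f)" "path (bend \<circ> g)"
    using assms by (auto intro!: path_continuous_image continuous_on_subset[OF continuous_on_bend])
  moreover have "path_image (bend \<circ> f) \<subseteq> cbox (vector [- 1, 0]) (vector [1, 1])"
      "path_image (bend \<circ> g) \<subseteq> cbox (vector [- 1, 0]) (vector [1, 1])"
    using assms bend_in_box by (auto simp: path_image_compose)
  ultimately obtain w where "w \<in> path_image (bend \<circ> f)" "w \<in> path_image (bend \<circ> g)"
    by (rule fashoda_interlace)
      (use assms in \<open>simp_all add: pathstart_compose pathfinish_compose bend_vertex_position\<close>)
  then obtain x y where xy: "x \<in> path_image f" "y \<in> path_image g" "bend x = bend y"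
    by (auto simp: path_image_compose)
  then have "x = y" using inj_onD[OF inj_on_bend] assms by blast
  then show ?thesis using xy by blast
qed

text \<open>The vertices and curves of one block form a path-connected subset of the rectangle, and
  the subsets of distinct blocks are disjoint. Interlacing blocks would contain paths that meet by
  \<open>interlaced_paths_meet\<close>.\<close>

lemma planar_imp_noncrossing:
  assumes "planar \<pi>"
  shows "noncrossing (blocks \<pi>)"
proof -
  define k V where "k = diagram_order \<pi>" and "V = vertices k"
  obtain E \<gamma> where
    E: "E \<subseteq> {{u, v} |u v. u \<in> V \<and> v \<in> V \<and> u \<noteq> v}" and
    comp: "graph_components V E = blocks \<pi>" and
    draw: "crossing_free_drawing k E \<gamma>"
    using assms unfolding planar_def k_def V_def by blast
  have EV: "e \<subseteq> V" "e \<noteq> {}" if "e \<in> E" for e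
    using subsetD[OF E that] by auto
  define adj where "adj = {(x, y). {x, y} \<in> E}\<^sup>*"
  \<comment> \<open>Including the vertex positions covers singleton blocks, which have no
    edges.\<close>
  define T where "T B = vertex_position ` B \<union> (\<Union>e\<in>{e \<in> E. e \<subseteq> B}. path_image (\<gamma> e))" for B
  have \<gamma>: "arc (\<gamma> e)" "{pathstart (\<gamma> e), pathfinish (\<gamma> e)} = vertex_position ` e"
      "path_image (\<gamma> e) \<subseteq> rectangle k"
      "path_image (\<gamma> e) \<inter> vertex_position ` V \<subseteq> vertex_position ` e" if "e \<in> E" for e
    using draw that unfolding crossing_free_drawing_def V_def by blast+
  have disj_edges: "path_image (\<gamma> e) \<inter> path_image (\<gamma> f) \<subseteq> vertex_position ` (e \<inter> f)"
    if "e \<in> E" "f \<in> E" "e \<noteq> f" for e f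
    using draw that unfolding crossing_free_drawing_def by blast
  have part: "partition_on V (blocks \<pi>)"
    unfolding V_def k_def by (rule partition_on_blocks)
  have block: "\<exists>x\<in>V. B = {y \<in> V. (x, y) \<in> adj}" if "B \<in> blocks \<pi>" for B
    using that unfolding comp[symmetric] graph_components_def adj_def[symmetric]
    by (auto simp: quotient_def)
  have connected: "path_component (T B) (vertex_position u) (vertex_position v)"
    if B: "B \<in> blocks \<pi>" and u: "u \<in> B" and v: "v \<in> B" for B u v
  proof -
    obtain x where x: "x \<in> V" "B = {y \<in> V. (x, y) \<in> adj}" using block[OF B] by blast
    \<comment> \<open>Walk along edges from the representative \<open>x\<close>. Every edge
      traversed stays inside \<open>B\<close>, so its curve is part of \<open>T B\<close>.\<close>
    have *: "y \<in> V \<and> path_component (T B) (vertex_position x) (vertex_position y)"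
      if "(x, y) \<in> adj" for y
      using that unfolding adj_def
    proof (induction rule: rtrancl_induct)
      case base
      have "x \<in> B" using x by (simp add: adj_def)
      then show ?case using x by (simp add: T_def path_component_refl)
    next
      case (step y z)
      then have e: "{y, z} \<in> E" by simp
      then have "z \<in> V" using EV by blast
      have sub: "{y, z} \<subseteq> B"
        using step \<open>z \<in> V\<close> unfolding x adj_def by (auto intro: rtrancl_into_rtrancl)
      have "path_component (T B) (pathstart (\<gamma> {y, z})) (pathfinish (\<gamma> {y, z}))"
        unfolding path_component_def
        using \<gamma>(1)[OF e] e sub by (intro exI[of _ "\<gamma> {y, z}"]) (auto simp: T_def arc_imp_path)
      \<comment> \<open>Only the set of endpoints is known, not the direction of the curve, hence
        the appeal to symmetry of \<open>path_component\<close>.\<close>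
      moreover have "{pathstart (\<gamma> {y, z}), pathfinish (\<gamma> {y, z})} =
          {vertex_position y, vertex_position z}"
        using \<gamma>(2)[OF e] by simp
      ultimately have "path_component (T B) (vertex_position y) (vertex_position z)"
        by (auto simp: doubleton_eq_iff intro: path_component_sym)
      then show ?case using step.IH \<open>z \<in> V\<close> path_component_trans by blast
    qed
    have "path_component (T B) (vertex_position x) (vertex_position u)"
      "path_component (T B) (vertex_position x) (vertex_position v)"
      using * u v x(2) by blast+
    then show ?thesis using path_component_sym path_component_trans by blast
  qed
  have T_rect: "T B \<subseteq> rectangle k" if "B \<in> blocks \<pi>" for B
    using \<gamma>(3) partition_onD1[OF part] that
    by (auto simp: T_def V_def intro!: vertex_position_in_rectangle)
  have T_disj: "T B \<inter> T C = {}" if B: "B \<in> blocks \<pi>" and C: "C \<in> blocks \<pi>" and "B \<noteq> C" for B C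
  proof -
    have BC: "B \<inter> C = {}"
      using partition_onD2[OF part] B C \<open>B \<noteq> C\<close> by (auto simp: disjoint_def)
    have sub: "B \<subseteq> V" "C \<subseteq> V" using partition_onD1[OF part] B C by auto
    \<comment> \<open>The drawing lets a curve pass only through the vertices of its own edge, all
      of which lie in \<open>Y\<close>.\<close>
    have ve: "vertex_position ` X \<inter> path_image (\<gamma> e) = {}"
      if "e \<in> E" "e \<subseteq> Y" "X \<inter> Y = {}" "X \<subseteq> V" for X Y e
    proof -
      have "x \<in> e" if "x \<in> X" "vertex_position x \<in> path_image (\<gamma> e)" for x
      proof -
        have "vertex_position x \<in> vertex_position ` e"
          using \<gamma>(4)[OF \<open>e \<in> E\<close>] \<open>X \<subseteq> V\<close> that by blast
        then show ?thesis by auto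
      qed
      then show ?thesis using \<open>e \<subseteq> Y\<close> \<open>X \<inter> Y = {}\<close> by blast
    qed
    have ee: "path_image (\<gamma> e) \<inter> path_image (\<gamma> f) = {}"
      if e: "e \<in> E" "e \<subseteq> B" and f: "f \<in> E" "f \<subseteq> C" for e f
    proof -
      \<comment> \<open>Edges inside disjoint blocks are disjoint and nonempty, hence different, so
        the crossing condition applies and leaves no common point.\<close>
      have "e \<inter> f = {}" using that BC by blast
      moreover have "e \<noteq> {}" using EV e by blast
      ultimately show ?thesis using disj_edges[OF e(1) f(1)] by auto
    qed
    have vv: "vertex_position ` B \<inter> vertex_position ` C = {}"
      using BC by auto
    have ev: "vertex_position ` C \<inter> path_image (\<gamma> e) = {}" if "e \<in> E" "e \<subseteq> B" for e
      by (rule ve[OF that]) (use BC sub in auto)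
    have ve': "vertex_position ` B \<inter> path_image (\<gamma> e) = {}" if "e \<in> E" "e \<subseteq> C" for e
      by (rule ve[OF that]) (use BC sub in auto)
    have T_iff: "p \<in> T X \<longleftrightarrow> p \<in> vertex_position ` X \<or> (\<exists>e\<in>E. e \<subseteq> X \<and> p \<in> path_image (\<gamma> e))" for p X
      by (auto simp: T_def)
    show ?thesis
      unfolding disjoint_iff T_iff
      by (meson vv[unfolded disjoint_iff] ev[unfolded disjoint_iff] ve'[unfolded disjoint_iff]
        ee[unfolded disjoint_iff])
  qed
  show ?thesis
    unfolding noncrossing_def
  proof (intro ballI impI)
    fix B C a b c d
    assume B: "B \<in> blocks \<pi>" and C: "C \<in> blocks \<pi>"
      and mem: "a \<in> B" "b \<in> C" "c \<in> B" "d \<in> C"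
      and less: "boundary_rank a < boundary_rank b" "boundary_rank b < boundary_rank c" "boundary_rank c < boundary_rank d"
    obtain f where f: "path f" "path_image f \<subseteq> T B"
      "pathstart f = vertex_position a" "pathfinish f = vertex_position c"
      using connected[OF B mem(1,3)] unfolding path_component_def by blast
    obtain g where g: "path g" "path_image g \<subseteq> T C"
      "pathstart g = vertex_position b" "pathfinish g = vertex_position d"
      using connected[OF C mem(2,4)] unfolding path_component_def by blast
    have "path_image f \<subseteq> rectangle k" "path_image g \<subseteq> rectangle k"
      using f(2) g(2) T_rect[OF B] T_rect[OF C] by auto
    then have "path_image f \<inter> path_image g \<noteq> {}"
      using f g less by (intro interlaced_paths_meet)
    then show "B = C" using T_disj[OF B C] f(2) g(2) by blast
  qed
qed

section \<open>Noncrossing diagrams are planar\<close>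

definition consecutive :: "vertex set \<Rightarrow> vertex \<Rightarrow> vertex \<Rightarrow> bool" where
  "consecutive B u v \<longleftrightarrow> u \<in> B \<and> v \<in> B \<and> boundary_rank u < boundary_rank v \<and>
     (\<forall>w\<in>B. \<not> (boundary_rank u < boundary_rank w \<and> boundary_rank w < boundary_rank v))"

text \<open>Induction on the number of elements of \<open>B\<close> after \<open>u\<close>: the one
  of lowest rank is consecutive to \<open>u\<close> and has fewer elements after it.\<close>

lemma consecutive_chain:
  assumes "finite B" "u \<in> B" "v \<in> B" "boundary_rank u \<le> boundary_rank v"
  shows "(u, v) \<in> {(x, y). consecutive B x y}\<^sup>*"
  using assms(2-)
proof (induction "card {w \<in> B. boundary_rank u < boundary_rank w}" arbitrary: u rule: less_induct)
  case less
  show ?case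
  proof (cases "u = v")
    case False
    let ?A = "\<lambda>u. {w \<in> B. boundary_rank u < boundary_rank w}"
    have "boundary_rank u \<noteq> boundary_rank v"
      using False by (simp add: inj_eq[OF inj_boundary_rank])
    then have v: "v \<in> ?A u" using less.prems by simp
    have fin: "finite (?A u)" using assms(1) by simp
    define w where "w = arg_min_on boundary_rank (?A u)"
    have w: "w \<in> ?A u" and min: "\<And>x. x \<in> ?A u \<Longrightarrow> boundary_rank w \<le> boundary_rank x"
      using arg_min_if_finite(1)[OF fin] arg_min_least[OF fin] v unfolding w_def by blast+
    have "consecutive B u w"
      using w less.prems(1) min by (force simp: consecutive_def)
    moreover have "(w, v) \<in> {(x, y). consecutive B x y}\<^sup>*"
    proof (rule less.hyps)
      show "card (?A w) < card (?A u)"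
        using w by (intro psubset_card_mono[OF fin]) (auto simp: psubset_eq)
    qed (use w min[OF v] less.prems in auto)
    ultimately show ?thesis by (auto intro: converse_rtrancl_into_rtrancl)
  qed simp
qed

section \<open>The curves of the drawing\<close>

text \<open>An edge between vertices of one row is drawn as a parabolic arch in the outer third of the
  rectangle next to that row. An edge from $i$ to $j'$ runs vertically in both outer thirds, so
  that it meets an arch at most at a vertex, and crosses over in the middle third.\<close>

definition arch :: "nat \<Rightarrow> nat \<Rightarrow> nat \<Rightarrow> real \<Rightarrow> real" where
  "arch k i j t = (real j - real i)\<^sup>2 / (real k)\<^sup>2 * (t * (1 - t))"

definition ramp :: "real \<Rightarrow> real" where
  "ramp y = min 1 (max 0 (3 * y - 1))"

text \<open>Edges are drawn only from lower to higher rank, and top vertices precede bottom ones, so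
  the case from bottom to top gets a default value. For the same reason \<open>i\<close> exceeds
  \<open>j\<close> whenever two bottom vertices are joined.\<close>

fun edge_curve :: "nat \<Rightarrow> vertex \<Rightarrow> vertex \<Rightarrow> real \<Rightarrow> real ^ 2" where
  "edge_curve k (Top i) (Top j) t = vector [real i + (real j - real i) * t, 1 - arch k i j t]"
| "edge_curve k (Bot i) (Bot j) t = vector [real i + (real j - real i) * t, arch k i j t]"
| "edge_curve k (Top i) (Bot j) t = vector [real j + (real i - real j) * ramp t, t]"
| "edge_curve k (Bot i) (Top j) t = undefined"

lemma ramp_bounds: "0 \<le> ramp y" "ramp y \<le> 1"
  by (simp_all add: ramp_def)

lemma ramp_low: "y \<le> 1/3 \<Longrightarrow> ramp y = 0"
  by (simp add: ramp_def)

lemma ramp_high: "2/3 \<le> y \<Longrightarrow> ramp y = 1"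
  by (simp add: ramp_def)

lemma arch_nonneg: "0 \<le> t \<Longrightarrow> t \<le> 1 \<Longrightarrow> 0 \<le> arch k i j t"
  by (simp add: arch_def)

text \<open>The scale factor is at most 1 and t(1 - t) is at most 1/4. As 1/4 < 1/3, an arch stays
  within the third where through edges are vertical.\<close>

lemma arch_le:
  assumes "0 \<le> t" "t \<le> 1" "1 \<le> i" "i \<le> k" "1 \<le> j" "j \<le> k"
  shows "arch k i j t \<le> 1/4"
proof -
  have "t * (1 - t) \<le> 1/4"
    using sum_squares_ge_zero[of "t - 1/2" 0] by (simp add: algebra_simps power2_eq_square)
  moreover have "(real j - real i)\<^sup>2 / (real k)\<^sup>2 \<le> 1"
    using assms by (auto simp: divide_le_eq_1 intro!: power2_le_iff_abs_le[THEN iffD2])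
  moreover have "0 \<le> t * (1 - t)" using assms by simp
  ultimately have "arch k i j t \<le> 1 * (1/4)"
    unfolding arch_def by (intro mult_mono) auto
  then show ?thesis by simp
qed

text \<open>Over the abscissa, all arches are parabolas with the same leading coefficient -1/k^2,
  thanks to the factor (j - i)^2 in \<open>arch\<close>. This common shape makes nested arches
  comparable.\<close>

lemma arch_abscissa:
  "x = real i + (real j - real i) * t \<Longrightarrow>
    arch k i j t = (x - real i) * (real j - x) / (real k)\<^sup>2"
proof -
  assume "x = real i + (real j - real i) * t"
  then have "x - real i = (real j - real i) * t" "real j - x = (real j - real i) * (1 - t)"
    by (simp_all add: algebra_simps)
  then show ?thesis by (simp add: arch_def power2_eq_square)
qed

text \<open>Intervals that do not cross are nested or overlap in at most one point. In the latter
  case \<open>x\<close> is that point. In the nested case the inner parabola lies below the outer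
  one, and equality forces a common endpoint at \<open>x\<close>.\<close>

lemma arches_meet:
  fixes i j i' j' x :: real
  assumes x: "i \<le> x" "x \<le> j" "i' \<le> x" "x \<le> j'"
    and eq: "(x - i) * (j - x) = (x - i') * (j' - x)"
    and nc: "\<not> (i < i' \<and> i' < j \<and> j < j')" "\<not> (i' < i \<and> i < j' \<and> j' < j)"
    and ne: "\<not> (i = i' \<and> j = j')"
  shows "x = i \<and> x = i' \<or> x = i \<and> x = j' \<or> x = j \<and> x = i' \<or> x = j \<and> x = j'"
proof -
  have nested: "x = a \<and> x = a' \<or> x = b \<and> x = b'"
    if "a \<le> a'" "b' \<le> b" "a' \<le> x" "x \<le> b'" "(x - a) * (b - x) = (x - a') * (b' - x)"
      "\<not> (a = a' \<and> b = b')" for a b a' b' :: real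
  proof -
    \<comment> \<open>The mixed product is squeezed between the two equal ones. Cancelling common
      factors then pins down \<open>x\<close>.\<close>
    have 1: "(x - a') * (b' - x) \<le> (x - a) * (b' - x)" "(x - a) * (b' - x) \<le> (x - a) * (b - x)"
      using that(1-4) by (simp_all add: mult_right_mono mult_left_mono)
    have "(x - a') * (b' - x) = (x - a) * (b' - x)"
      using 1(1) 1(2)[unfolded that(5)] by (rule order.antisym)
    moreover from trans[OF this[symmetric] that(5)[symmetric]]
    have "(x - a) * (b' - x) = (x - a) * (b - x)" .
    ultimately have "b' - x = 0 \<or> x - a' = x - a" "x - a = 0 \<or> b' - x = b - x"
      unfolding mult_cancel_left mult_cancel_right by blast+
    then show ?thesis using that by auto
  qed
  consider "j \<le> i'" | "j' \<le> i" | "i \<le> i'" "j' \<le> j" | "i' \<le> i" "j \<le> j'"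
    using nc by linarith
  then show ?thesis
  proof cases
    case 3
    then show ?thesis using nested[of i i' j' j] x eq ne by auto
  next
    case 4
    then show ?thesis using nested[of i' i j j'] x eq ne by auto
  qed (use x in auto)
qed

lemma convex_bounds:
  fixes a b t :: real
  assumes "0 \<le> t" "t \<le> 1" "a \<le> b"
  shows "a \<le> a + (b - a) * t" "a + (b - a) * t \<le> b" "a \<le> b + (a - b) * t" "b + (a - b) * t \<le> b"
proof -
  have "0 \<le> (b - a) * t" "(b - a) * t \<le> b - a"
    using assms by (simp_all add: mult_left_le)
  then show "a \<le> a + (b - a) * t" "a + (b - a) * t \<le> b" "a \<le> b + (a - b) * t" "b + (a - b) * t \<le> b"
    by (simp_all add: algebra_simps)
qed

text \<open>This and its analogues for the other two kinds of edges eliminate the curve parameter,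
  so that the intersection arguments work with coordinates alone. The bound 3/4 puts the arch inside
  the upper third.\<close>

lemma top_edge_image:
  assumes "p \<in> path_image (edge_curve k (Top i) (Top j))" "1 \<le> i" "i < j" "j \<le> k"
  shows "real i \<le> p $ 1" "p $ 1 \<le> real j" "3/4 \<le> p $ 2" "p $ 2 \<le> 1"
    "1 - p $ 2 = (p $ 1 - real i) * (real j - p $ 1) / (real k)\<^sup>2"
proof -
  obtain t where t: "0 \<le> t" "t \<le> 1" "p = edge_curve k (Top i) (Top j) t"
    using assms(1) by (auto simp: path_image_def)
  show "real i \<le> p $ 1" "p $ 1 \<le> real j"
    using convex_bounds[OF t(1,2)] assms(3) t(3) by simp_all
  show "3/4 \<le> p $ 2" using arch_le[OF t(1,2), of i k j] assms t(3) by simp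
  show "p $ 2 \<le> 1" using arch_nonneg[OF t(1,2)] t(3) by simp
  show "1 - p $ 2 = (p $ 1 - real i) * (real j - p $ 1) / (real k)\<^sup>2"
    using arch_abscissa[of "p $ 1" i j t k] t(3) by simp
qed

lemma bottom_edge_image:
  assumes "p \<in> path_image (edge_curve k (Bot i) (Bot j))" "1 \<le> j" "j < i" "i \<le> k"
  shows "real j \<le> p $ 1" "p $ 1 \<le> real i" "0 \<le> p $ 2" "p $ 2 \<le> 1/4"
    "p $ 2 = (p $ 1 - real j) * (real i - p $ 1) / (real k)\<^sup>2"
proof -
  obtain t where t: "0 \<le> t" "t \<le> 1" "p = edge_curve k (Bot i) (Bot j) t"
    using assms(1) by (auto simp: path_image_def)
  show "real j \<le> p $ 1" "p $ 1 \<le> real i"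
    using convex_bounds[OF t(1,2)] assms(3) t(3) by simp_all
  show "p $ 2 \<le> 1/4" using arch_le[OF t(1,2), of i k j] assms t(3) by simp
  show "0 \<le> p $ 2" using arch_nonneg[OF t(1,2)] t(3) by simp
  show "p $ 2 = (p $ 1 - real j) * (real i - p $ 1) / (real k)\<^sup>2"
    using arch_abscissa[of "p $ 1" i j t k] t(3) by (simp add: algebra_simps)
qed

lemma through_edge_image:
  assumes "p \<in> path_image (edge_curve k (Top i) (Bot j))"
  shows "0 \<le> p $ 2" "p $ 2 \<le> 1" "p $ 1 = real j + (real i - real j) * ramp (p $ 2)"
  using assms by (auto simp: path_image_def)

lemma through_edge_image_low:
  "p \<in> path_image (edge_curve k (Top i) (Bot j)) \<Longrightarrow> p $ 2 \<le> 1/3 \<Longrightarrow> p $ 1 = real j"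
  by (auto dest!: through_edge_image(3) simp: ramp_low)

lemma through_edge_image_high:
  "p \<in> path_image (edge_curve k (Top i) (Bot j)) \<Longrightarrow> 2/3 \<le> p $ 2 \<Longrightarrow> p $ 1 = real i"
  by (auto dest!: through_edge_image(3) simp: ramp_high)

lemma edge_cases:
  assumes "boundary_rank u < boundary_rank v" "u \<in> vertices k" "v \<in> vertices k"
  obtains (top) i j where "u = Top i" "v = Top j" "1 \<le> i" "i < j" "j \<le> k"
  | (bottom) i j where "u = Bot i" "v = Bot j" "1 \<le> j" "j < i" "i \<le> k"
  | (through) i j where "u = Top i" "v = Bot j" "1 \<le> i" "i \<le> k" "1 \<le> j" "j \<le> k"
proof (cases u; cases v)
  fix i j assume "u = Top i" "v = Top j"
  then show ?thesis using assms by (intro top) (auto simp: vertices_def)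
next
  fix i j assume "u = Top i" "v = Bot j"
  then show ?thesis using assms by (intro through) (auto simp: vertices_def)
next
  fix i j assume "u = Bot i" "v = Top j"
  then show ?thesis using assms by simp
next
  fix i j assume "u = Bot i" "v = Bot j"
  then show ?thesis using assms by (intro bottom) (auto simp: vertices_def)
qed

text \<open>Arches are injective because the abscissa is affine and nonconstant in the parameter,
  through edges because the ordinate is the parameter. An arch reaches its row only where its
  parabola vanishes, and a through edge reaches each row at the abscissa of its end there.\<close>

lemma edge_curve_drawing:
  assumes "boundary_rank u < boundary_rank v" "u \<in> vertices k" "v \<in> vertices k"
  shows "arc (edge_curve k u v)"
    and "{pathstart (edge_curve k u v), pathfinish (edge_curve k u v)} = vertex_position ` {u, v}"
    and "path_image (edge_curve k u v) \<subseteq> rectangle k"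
    and "path_image (edge_curve k u v) \<inter> vertex_position ` vertices k \<subseteq> vertex_position ` {u, v}"
proof -
  have "arc (edge_curve k u v) \<and>
    {pathstart (edge_curve k u v), pathfinish (edge_curve k u v)} = vertex_position ` {u, v} \<and>
    path_image (edge_curve k u v) \<subseteq> rectangle k \<and>
    path_image (edge_curve k u v) \<inter> vertex_position ` vertices k \<subseteq> vertex_position ` {u, v}"
    using assms
  proof (cases rule: edge_cases)
    case (top i j)
    have "path (edge_curve k u v)"
      unfolding top path_def edge_curve.simps arch_def
      by (intro continuous_on_vector2 continuous_intros) (use top in auto)
    moreover have "inj_on (edge_curve k u v) {0..1}"
      using top by (auto intro!: inj_onI simp: vec2_eq_iff)
    moreover have "{pathstart (edge_curve k u v), pathfinish (edge_curve k u v)} =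
        vertex_position ` {u, v}"
      by (simp add: top pathstart_def pathfinish_def arch_def vertex_position_def)
    moreover have "p \<in> rectangle k" if "p \<in> path_image (edge_curve k u v)" for p
      using top_edge_image(1-4)[OF that[unfolded top] top(3-)] top(3-) by (simp add: rectangle_iff)
    moreover have "w \<in> {u, v}" if "vertex_position w \<in> path_image (edge_curve k u v)" for w
      using top_edge_image[OF that[unfolded top] top(3-)] top by (cases w) auto
    ultimately show ?thesis by (auto simp: arc_def)
  next
    case (bottom i j)
    have "path (edge_curve k u v)"
      unfolding bottom path_def edge_curve.simps arch_def
      by (intro continuous_on_vector2 continuous_intros) (use bottom in auto)
    moreover have "inj_on (edge_curve k u v) {0..1}"
      using bottom by (auto intro!: inj_onI simp: vec2_eq_iff)
    moreover have "{pathstart (edge_curve k u v), pathfinish (edge_curve k u v)} =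
        vertex_position ` {u, v}"
      by (simp add: bottom pathstart_def pathfinish_def arch_def vertex_position_def)
    moreover have "p \<in> rectangle k" if "p \<in> path_image (edge_curve k u v)" for p
      using bottom_edge_image(1-4)[OF that[unfolded bottom] bottom(3-)] bottom(3-)
      by (simp add: rectangle_iff)
    moreover have "w \<in> {u, v}" if "vertex_position w \<in> path_image (edge_curve k u v)" for w
      using bottom_edge_image[OF that[unfolded bottom] bottom(3-)] bottom by (cases w) auto
    ultimately show ?thesis by (auto simp: arc_def)
  next
    case (through i j)
    have "path (edge_curve k u v)"
      unfolding through path_def edge_curve.simps ramp_def
      by (intro continuous_on_vector2 continuous_intros)
    moreover have "inj_on (edge_curve k u v) {0..1}"
      using through by (auto intro!: inj_onI simp: vec2_eq_iff)
    moreover have "{pathstart (edge_curve k u v), pathfinish (edge_curve k u v)} =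
        vertex_position ` {u, v}"
      by (auto simp add: through pathstart_def pathfinish_def ramp_def vertex_position_def)
    moreover have "p \<in> rectangle k" if "p \<in> path_image (edge_curve k u v)" for p
    proof -
      note p = through_edge_image[OF that[unfolded through(1,2)]]
      have "1 \<le> p $ 1 \<and> p $ 1 \<le> real k"
      proof (cases "i \<le> j")
        case True
        then show ?thesis
          using convex_bounds(3,4)[OF ramp_bounds, of "real i" "real j" "p $ 2"] p(3) through by simp
      next
        case False
        then show ?thesis
          using convex_bounds(1,2)[OF ramp_bounds, of "real j" "real i" "p $ 2"] p(3) through by simp
      qed
      then show ?thesis using p by (simp add: rectangle_iff)
    qed
    moreover have "w \<in> {u, v}" if "vertex_position w \<in> path_image (edge_curve k u v)" for w
      using through_edge_image_low[OF that[unfolded through(1,2)]]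
        through_edge_image_high[OF that[unfolded through(1,2)]] through by (cases w) auto
    ultimately show ?thesis by (auto simp: arc_def)
  qed
  then show "arc (edge_curve k u v)"
    and "{pathstart (edge_curve k u v), pathfinish (edge_curve k u v)} = vertex_position ` {u, v}"
    and "path_image (edge_curve k u v) \<subseteq> rectangle k"
    and "path_image (edge_curve k u v) \<inter> vertex_position ` vertices k \<subseteq> vertex_position ` {u, v}"
    by blast+
qed

text \<open>At a given height the difference of the abscissae is a convex combination of the
  positive differences of the bottom ends and of the top ends, hence positive.\<close>

lemma through_edges_disjoint:
  assumes "p \<in> path_image (edge_curve k (Top i) (Bot j))"
    and "p \<in> path_image (edge_curve k (Top i') (Bot j'))"
    and "i < i'" "j < j'"
  shows False
proof -
  define s where "s = ramp (p $ 2)"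
  have s: "0 \<le> s" "s \<le> 1" by (simp_all add: s_def ramp_bounds)
  have "0 = (1 - s) * (real j' - real j) + s * (real i' - real i)"
    using through_edge_image(3)[OF assms(1)] through_edge_image(3)[OF assms(2)]
    by (simp add: s_def algebra_simps)
  moreover have "0 < (1 - s) * (real j' - real j) + s * (real i' - real i)"
  proof (cases "s = 1")
    case False
    then show ?thesis using s assms(3,4) by (intro add_pos_nonneg mult_pos_pos mult_nonneg_nonneg) auto
  qed (use assms in simp)
  ultimately show False by simp
qed

text \<open>Here \<open>x\<close> is the abscissa of a vertical part of a through edge. Outside the
  open span of an arch it can meet the closed span only at an end, where the arch touches its
  row.\<close>

lemma through_arch_meet:
  fixes x y k :: real
  assumes "y = (x - a) * (b - x) / k\<^sup>2" "a \<le> x" "x \<le> b" "\<not> (a < x \<and> x < b)"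
  shows "y = 0" "x = a \<or> x = b"
  using assms by auto

text \<open>Arches of different rows are separated by height, and arches of one row are settled by
  \<open>arches_meet\<close>. An arch meets a through edge only where the latter is vertical, and
  noncrossing keeps that abscissa out of the open span of the arch. Two through edges with a common
  end would overlap along the vertical part there, which \<open>through_ne\<close> excludes.\<close>

lemma edge_curves_crossing_free:
  assumes "boundary_rank u < boundary_rank v" "u \<in> vertices k" "v \<in> vertices k"
    and "boundary_rank u' < boundary_rank v'" "u' \<in> vertices k" "v' \<in> vertices k"
    and nc: "\<not> (boundary_rank u < boundary_rank u' \<and> boundary_rank u' < boundary_rank v \<and>
        boundary_rank v < boundary_rank v')"
      "\<not> (boundary_rank u' < boundary_rank u \<and> boundary_rank u < boundary_rank v' \<and>
        boundary_rank v' < boundary_rank v)"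
    and ne: "\<not> (u = u' \<and> v = v')"
    and through_ne: "\<And>i i' j j'. u = Top i \<Longrightarrow> v = Bot j \<Longrightarrow> u' = Top i' \<Longrightarrow> v' = Bot j' \<Longrightarrow>
      i \<noteq> i' \<and> j \<noteq> j'"
  shows "path_image (edge_curve k u v) \<inter> path_image (edge_curve k u' v') \<subseteq>
    vertex_position ` ({u, v} \<inter> {u', v'})"
proof
  fix p assume "p \<in> path_image (edge_curve k u v) \<inter> path_image (edge_curve k u' v')"
  then have p: "p \<in> path_image (edge_curve k u v)" "p \<in> path_image (edge_curve k u' v')"
    by simp_all
  \<comment> \<open>The edges are left generic, because either of the two given edges may be the
    arch.\<close>
  have top_through: "p = vertex_position x \<and> x \<in> {Top i, Top j}"
    if "p \<in> path_image (edge_curve k (Top i) (Top j))" "1 \<le> i" "i < j" "j \<le> k"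
      "p \<in> path_image (edge_curve k x y)" "x = Top a" "y = Bot b" "\<not> (i < a \<and> a < j)" for i j x y a b
  proof -
    note q = top_edge_image[OF that(1-4)]
    have "p $ 1 = real a"
      using q(3) that(5) by (intro through_edge_image_high) (auto simp: that)
    then have "1 - p $ 2 = 0" "p $ 1 = real i \<or> p $ 1 = real j"
      using through_arch_meet[OF q(5,1,2)] that by auto
    then show ?thesis using \<open>p $ 1 = real a\<close> that by (auto simp: vec2_eq_iff)
  qed
  have bottom_through: "p = vertex_position y \<and> y \<in> {Bot i, Bot j}"
    if "p \<in> path_image (edge_curve k (Bot i) (Bot j))" "1 \<le> j" "j < i" "i \<le> k"
      "p \<in> path_image (edge_curve k x y)" "x = Top a" "y = Bot b" "\<not> (j < b \<and> b < i)" for i j x y a b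
  proof -
    note q = bottom_edge_image[OF that(1-4)]
    have "p $ 1 = real b"
      using q(4) that(5) by (intro through_edge_image_low) (auto simp: that)
    then have "p $ 2 = 0" "p $ 1 = real j \<or> p $ 1 = real i"
      using through_arch_meet[OF q(5,1,2)] that by auto
    then show ?thesis using \<open>p $ 1 = real b\<close> that by (auto simp: vec2_eq_iff)
  qed
  show "p \<in> vertex_position ` ({u, v} \<inter> {u', v'})"
    using assms(1-3)
  proof (cases rule: edge_cases)
    case T: (top i j)
    note q = top_edge_image[OF p(1)[unfolded T] T(3-)]
    show ?thesis
      using assms(4-6)
    proof (cases rule: edge_cases)
      case T': (top i' j')
      note q' = top_edge_image[OF p(2)[unfolded T'] T'(3-)]
      have *: "p $ 1 = i \<and> p $ 1 = i' \<or> p $ 1 = i \<and> p $ 1 = j' \<or>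
          p $ 1 = j \<and> p $ 1 = i' \<or> p $ 1 = j \<and> p $ 1 = j'"
        using q(5) q'(5) T T' nc ne by (intro arches_meet[OF q(1,2) q'(1,2)]) auto
      then have "p $ 2 = 1" using q(5) by auto
      moreover from * obtain m where "m \<in> {i, j} \<inter> {i', j'}" "p $ 1 = real m" by force
      ultimately show ?thesis
        using T T' by (intro image_eqI[of _ _ "Top m"]) (auto simp: vec2_eq_iff)
    next
      case (bottom i' j')
      then show ?thesis
        using bottom_edge_image[OF p(2)[unfolded bottom] bottom(3-)] q by simp
    next
      case (through i' j')
      then show ?thesis
        using top_through[OF p(1)[unfolded T] T(3-) p(2) through(1,2)] T nc by auto
    qed
  next
    case B: (bottom i j)
    note q = bottom_edge_image[OF p(1)[unfolded B] B(3-)]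
    show ?thesis
      using assms(4-6)
    proof (cases rule: edge_cases)
      case (top i' j')
      then show ?thesis
        using top_edge_image[OF p(2)[unfolded top] top(3-)] q by simp
    next
      case B': (bottom i' j')
      note q' = bottom_edge_image[OF p(2)[unfolded B'] B'(3-)]
      have *: "p $ 1 = j \<and> p $ 1 = j' \<or> p $ 1 = j \<and> p $ 1 = i' \<or>
          p $ 1 = i \<and> p $ 1 = j' \<or> p $ 1 = i \<and> p $ 1 = i'"
        using q(5) q'(5) B B' nc ne by (intro arches_meet[OF q(1,2) q'(1,2)]) auto
      then have "p $ 2 = 0" using q(5) by auto
      moreover from * obtain m where "m \<in> {i, j} \<inter> {i', j'}" "p $ 1 = real m" by force
      ultimately show ?thesis
        using B B' by (intro image_eqI[of _ _ "Bot m"]) (auto simp: vec2_eq_iff)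
    next
      case (through i' j')
      then show ?thesis
        using bottom_through[OF p(1)[unfolded B] B(3-) p(2) through(1,2)] B nc by auto
    qed
  next
    case Th: (through i j)
    show ?thesis
      using assms(4-6)
    proof (cases rule: edge_cases)
      case (top i' j')
      then show ?thesis
        using top_through[OF p(2)[unfolded top] top(3-) p(1) Th(1,2)] Th nc by auto
    next
      case (bottom i' j')
      then show ?thesis
        using bottom_through[OF p(2)[unfolded bottom] bottom(3-) p(1) Th(1,2)] Th nc by auto
    next
      case (through i' j')
      \<comment> \<open>Ranks decrease from left to right on the bottom row, so noncrossing orders
        the bottom ends like the top ends.\<close>
      have "i < i' \<and> j < j' \<or> i' < i \<and> j' < j"
        using nc through_ne[OF Th(1,2) through(1,2)] Th through by auto
      then show ?thesis
        using through_edges_disjoint p unfolding Th through by blast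
    qed
  qed
qed

text \<open>The edges are the pairs of consecutive vertices of blocks. By
  \<open>consecutive_chain\<close> they connect each block, and they never leave it, so the
  components are the blocks.\<close>

lemma noncrossing_imp_planar:
  assumes nc: "noncrossing (blocks \<pi>)"
  shows "planar \<pi>"
proof -
  define k where "k = diagram_order \<pi>"
  let ?P = "blocks \<pi>"
  have part: "partition_on (vertices k) ?P"
    unfolding k_def by (rule partition_on_blocks)
  have sub: "B \<subseteq> vertices k" if "B \<in> ?P" for B
    using partition_onD1[OF part] that by auto
  have same: "B = C" if "B \<in> ?P" "C \<in> ?P" "x \<in> B" "x \<in> C" for B C x
    using partition_onD2[OF part] that by (auto simp: disjoint_def)
  define edge where "edge e p \<longleftrightarrow> e = {fst p, snd p} \<and> (\<exists>B\<in>?P. consecutive B (fst p) (snd p))" for e p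
  define E where "E = {e. \<exists>p. edge e p}"
  \<comment> \<open>An edge is an unordered pair, so a choice fixes the ordered consecutive pair
    whose curve represents it.\<close>
  define ends where "ends e = (SOME p. edge e p)" for e
  define \<gamma> where "\<gamma> e = edge_curve k (fst (ends e)) (snd (ends e))" for e
  have edge: "\<exists>B u v. B \<in> ?P \<and> e = {u, v} \<and> consecutive B u v \<and> \<gamma> e = edge_curve k u v"
    if "e \<in> E" for e
  proof -
    have "\<exists>p. edge e p" using that by (simp add: E_def)
    then have "edge e (ends e)" unfolding ends_def by (rule someI_ex)
    then show ?thesis unfolding edge_def \<gamma>_def by blast
  qed
  have edgeI: "{u, v} \<in> E" if "B \<in> ?P" "consecutive B u v" for B u v
    using that unfolding E_def edge_def by auto
  have consD: "u \<in> vertices k" "v \<in> vertices k" "boundary_rank u < boundary_rank v" "u \<noteq> v"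
    if "B \<in> ?P" "consecutive B u v" for B u v
    using that sub[of B] by (auto simp: consecutive_def)
  let ?adj = "{(x, y). {x, y} \<in> E}\<^sup>*"
  have stay: "y \<in> B" if "(x, y) \<in> ?adj" "B \<in> ?P" "x \<in> B" for x y B
    using that(1)
  proof (induction rule: rtrancl_induct)
    case (step y z)
    then obtain C u v where C: "C \<in> ?P" "{y, z} = {u, v}" "consecutive C u v"
      using edge[of "{y, z}"] by auto
    then have "{y, z} \<subseteq> C" by (simp add: consecutive_def)
    then show ?case using same[OF \<open>B \<in> ?P\<close> C(1) step.IH] by simp
  qed (rule that(3))
  have sym: "sym ?adj"
    by (intro sym_rtrancl symI) (simp add: insert_commute)
  have join: "(x, y) \<in> ?adj" if B: "B \<in> ?P" and xy: "x \<in> B" "y \<in> B" for x y B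
  proof -
    have "finite B" using finite_subset[OF sub[OF B] finite_vertices] .
    have le: "(x, y) \<in> ?adj" if "x \<in> B" "y \<in> B" "boundary_rank x \<le> boundary_rank y" for x y
      using consecutive_chain[OF \<open>finite B\<close> that]
      by (rule rtrancl_mono[THEN subsetD, rotated]) (use edgeI[OF B] in auto)
    show ?thesis
      using le[OF xy] le[OF xy(2,1)] symD[OF sym] by (cases "boundary_rank x \<le> boundary_rank y") auto
  qed
  have "{(u, v). u \<in> vertices k \<and> v \<in> vertices k \<and> (u, v) \<in> ?adj} =
      {(x, y). \<exists>B\<in>?P. x \<in> B \<and> y \<in> B}" (is "?L = ?R")
  proof
    show "?L \<subseteq> ?R"
    proof safe
      fix u v assume "u \<in> vertices k" "(u, v) \<in> ?adj"
      moreover from this obtain B where "B \<in> ?P" "u \<in> B"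
        using partition_onD1[OF part] by auto
      ultimately show "\<exists>B\<in>?P. u \<in> B \<and> v \<in> B" using stay by blast
    qed
    show "?R \<subseteq> ?L" using join sub by blast
  qed
  then have comp: "graph_components (vertices k) E = ?P"
    unfolding graph_components_def using partition_on_eq_quotient[OF part] by simp
  have "crossing_free_drawing k E \<gamma>"
    unfolding crossing_free_drawing_def
  proof (intro conjI[of "\<forall>e\<in>E. _ e"] ballI impI)
    fix e assume "e \<in> E"
    then obtain B u v where "B \<in> ?P" "e = {u, v}" "consecutive B u v" "\<gamma> e = edge_curve k u v"
      using edge by blast
    then show "arc (\<gamma> e) \<and> {pathstart (\<gamma> e), pathfinish (\<gamma> e)} = vertex_position ` e \<and>
        path_image (\<gamma> e) \<subseteq> rectangle k \<and>
        path_image (\<gamma> e) \<inter> vertex_position ` vertices k \<subseteq> vertex_position ` e"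
      using edge_curve_drawing[OF consD(3,1,2)] by simp
  next
    fix e e' assume e: "e \<in> E" and e': "e' \<in> E" and "e \<noteq> e'"
    obtain B u v where B: "B \<in> ?P" "e = {u, v}" "consecutive B u v" "\<gamma> e = edge_curve k u v"
      using edge[OF e] by blast
    obtain C u' v' where C: "C \<in> ?P" "e' = {u', v'}" "consecutive C u' v'" "\<gamma> e' = edge_curve k u' v'"
      using edge[OF e'] by blast
    have nc': "\<not> (boundary_rank u < boundary_rank u' \<and> boundary_rank u' < boundary_rank v \<and>
        boundary_rank v < boundary_rank v')"
      if "B \<in> ?P" "consecutive B u v" "C \<in> ?P" "consecutive C u' v'" for B C u v u' v'
      using that noncrossingD[OF nc that(1,3), of u u' v v'] unfolding consecutive_def by blast
    show "path_image (\<gamma> e) \<inter> path_image (\<gamma> e') \<subseteq> vertex_position ` (e \<inter> e')"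
      unfolding B(4) C(4) unfolding B(2) C(2)
    proof (rule edge_curves_crossing_free)
      show "\<not> (u = u' \<and> v = v')" using \<open>e \<noteq> e'\<close> B(2) C(2) by auto
      fix i i' j j' assume ij: "u = Top i" "v = Bot j" "u' = Top i'" "v' = Bot j'"
      \<comment> \<open>Within one block, a consecutive pair from top to bottom consists of the last
        top vertex and the first bottom vertex in boundary order, so there is at most one. Edges
        from different blocks share no vertex.\<close>
      have "B \<noteq> C"
      proof
        assume "B = C"
        then have "\<not> boundary_rank u < boundary_rank u'" "\<not> boundary_rank u' < boundary_rank u"
          "\<not> boundary_rank v < boundary_rank v'" "\<not> boundary_rank v' < boundary_rank v"
          using B(3) C(3) unfolding consecutive_def ij by auto
        then have "u = u'" "v = v'" unfolding ij by auto
        then show False using \<open>e \<noteq> e'\<close> B(2) C(2) by simp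
      qed
      then have "u \<noteq> u'" "v \<noteq> v'"
        using same[OF B(1) C(1)] B(3) C(3) by (auto simp: consecutive_def)
      then show "i \<noteq> i' \<and> j \<noteq> j'" using ij by simp
    qed (rule consD[OF B(1,3)] consD[OF C(1,3)] nc'[OF B(1,3) C(1,3)] nc'[OF C(1,3) B(1,3)])+
  qed
  moreover have "E \<subseteq> {{u, v} |u v. u \<in> vertices k \<and> v \<in> vertices k \<and> u \<noteq> v}"
  proof
    fix e assume "e \<in> E"
    then obtain B u v where B: "B \<in> ?P" "e = {u, v}" "consecutive B u v"
      using edge by blast
    show "e \<in> {{u, v} |u v. u \<in> vertices k \<and> v \<in> vertices k \<and> u \<noteq> v}"
      using consD[OF B(1,3)] B(2) by blast
  qed
  ultimately show ?thesis
    unfolding planar_def k_def[symmetric] using comp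
    by (intro exI[of _ E] exI[of _ \<gamma>] conjI)
qed

theorem planar_iff_noncrossing: "planar \<pi> \<longleftrightarrow> noncrossing (blocks \<pi>)"
  using planar_imp_noncrossing noncrossing_imp_planar by blast

section \<open>Noncrossing diagrams under the two products\<close>

text \<open>The shift preserves the boundary order, so interlacing members of \<open>P\<close> give
  interlacing members of \<open>Q\<close>, which must coincide. In the applications \<open>f\<close>
  sends a block of a factor to the block of the product that contains it.\<close>

lemma noncrossing_coarser:
  assumes nc: "noncrossing Q"
    and f: "\<And>B. B \<in> P \<Longrightarrow> f B \<in> Q" "\<And>B. B \<in> P \<Longrightarrow> shift k ` B \<subseteq> f B" "inj_on f P"
  shows "noncrossing P"
  unfolding noncrossing_def
proof (intro ballI impI)
  fix B C a b c d
  assume B: "B \<in> P" and C: "C \<in> P" and mem: "a \<in> B" "b \<in> C" "c \<in> B" "d \<in> C"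
    and less: "boundary_rank a < boundary_rank b" "boundary_rank b < boundary_rank c"
      "boundary_rank c < boundary_rank d"
  have "shift k a \<in> f B" "shift k c \<in> f B" "shift k b \<in> f C" "shift k d \<in> f C"
    using f(2)[OF B] f(2)[OF C] mem by auto
  then have "f B = f C"
    using less noncrossingD[OF nc f(1)[OF B] f(1)[OF C], of "shift k a" "shift k b" "shift k c" "shift k d"]
    by simp
  then show "B = C" using inj_onD[OF f(3)] B C by simp
qed

lemma blocks_0: "blocks 0 = {}"
  by transfer simp

lemma blocks_disjoint:
  "B \<in> blocks \<pi> \<Longrightarrow> C \<in> blocks \<pi> \<Longrightarrow> x \<in> B \<Longrightarrow> x \<in> C \<Longrightarrow> B = C"
  using partition_onD2[OF partition_on_blocks[of \<pi>]] by (auto simp: disjoint_def)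

lemma blocks_subset: "B \<in> blocks \<pi> \<Longrightarrow> B \<subseteq> vertices (diagram_order \<pi>)"
  using partition_onD1[OF partition_on_blocks[of \<pi>]] by blast

text \<open>In boundary order the vertices of the second factor form an interval between the top and
  the bottom vertices of the first, so blocks from different factors cannot interlace.\<close>

lemma noncrossing_add:
  assumes "noncrossing (blocks \<pi>)" "noncrossing (blocks \<rho>)"
  shows "noncrossing (blocks (\<pi> + \<rho>))"
proof -
  define k where "k = diagram_order \<pi>"
  \<comment> \<open>The vertex \<open>b\<close> of the second factor forces \<open>a\<close> into
    the top row and \<open>c\<close> into the bottom row, and then every vertex of the second factor
    lies between them.\<close>
  have between: False
    if "a \<in> vertices k" "c \<in> vertices k" "b \<in> shift k ` vertices l" "d \<in> shift k ` vertices l"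
      "boundary_rank a < boundary_rank b" "boundary_rank b < boundary_rank c"
      "boundary_rank c < boundary_rank d \<or> boundary_rank d < boundary_rank a" for a b c d l
    using that by (cases a; cases b; cases c; cases d) (auto simp: vertices_def)
  show ?thesis
    unfolding noncrossing_def
  proof (intro ballI impI)
    fix B C a b c d
    assume B: "B \<in> blocks (\<pi> + \<rho>)" and C: "C \<in> blocks (\<pi> + \<rho>)"
      and mem: "a \<in> B" "b \<in> C" "c \<in> B" "d \<in> C"
      and less: "boundary_rank a < boundary_rank b" "boundary_rank b < boundary_rank c"
        "boundary_rank c < boundary_rank d"
    have sub: "X \<subseteq> vertices k" if "X \<in> blocks \<pi>" for X
      using blocks_subset[OF that] by (simp add: k_def)
    have subs: "shift k ` X \<subseteq> shift k ` vertices (diagram_order \<rho>)" if "X \<in> blocks \<rho>" for X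
      using blocks_subset[OF that] by blast
    consider "B \<in> blocks \<pi>" "C \<in> blocks \<pi>"
      | B' C' where "B' \<in> blocks \<rho>" "C' \<in> blocks \<rho>" "B = shift k ` B'" "C = shift k ` C'"
      | C' where "B \<in> blocks \<pi>" "C' \<in> blocks \<rho>" "C = shift k ` C'"
      | B' where "B' \<in> blocks \<rho>" "C \<in> blocks \<pi>" "B = shift k ` B'"
      using B C unfolding blocks_add k_def by blast
    then show "B = C"
    proof cases
      case 1
      then show ?thesis using noncrossingD[OF assms(1)] mem less by blast
    next
      case 2
      then obtain a' b' c' d' where "a' \<in> B'" "c' \<in> B'" "b' \<in> C'" "d' \<in> C'"
        "a = shift k a'" "b = shift k b'" "c = shift k c'" "d = shift k d'"
        using mem by blast
      then have "B' = C'" using noncrossingD[OF assms(2) 2(1,2)] less by simp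
      then show ?thesis using 2 by simp
    next
      case 3
      have "a \<in> vertices k" "c \<in> vertices k" using sub[OF 3(1)] mem by auto
      moreover have "b \<in> shift k ` vertices (diagram_order \<rho>)"
        "d \<in> shift k ` vertices (diagram_order \<rho>)" using subs[OF 3(2)] mem 3(3) by auto
      ultimately show ?thesis using between[of a c b "diagram_order \<rho>" d] less by simp
    next
      case 4
      have "b \<in> vertices k" "d \<in> vertices k" using sub[OF 4(2)] mem by auto
      moreover have "a \<in> shift k ` vertices (diagram_order \<rho>)"
        "c \<in> shift k ` vertices (diagram_order \<rho>)" using subs[OF 4(1)] mem 4(3) by auto
      ultimately show ?thesis using between[of b d c "diagram_order \<rho>" a] less by simp
    qed
  qed
qed

lemma inj_image_shift: "inj ((`) (shift k))"
  by (intro injI) (simp add: inj_image_eq_iff[OF inj_shift])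

lemma noncrossing_addD:
  assumes "noncrossing (blocks (\<pi> + \<rho>))"
  shows "noncrossing (blocks \<pi>)" "noncrossing (blocks \<rho>)"
proof -
  show "noncrossing (blocks \<pi>)"
    by (rule noncrossing_coarser[OF assms, where f = "\<lambda>B. B" and k = 0])
      (simp_all add: blocks_add shift_0)
  show "noncrossing (blocks \<rho>)"
    by (rule noncrossing_coarser[OF assms, where f = "(`) (shift (diagram_order \<pi>))" and k = "diagram_order \<pi>"])
      (simp_all add: blocks_add inj_on_subset[OF inj_image_shift])
qed

section \<open>Merging two blocks\<close>

lemma blocks_merge_blocks:
  "blocks (merge_blocks u v \<sigma>) = {B \<in> blocks \<sigma>. u \<notin> B \<and> v \<notin> B} \<union>
     ({\<Union>{B \<in> blocks \<sigma>. u \<in> B \<or> v \<in> B}} - {{}})"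
  by transfer auto

text \<open>On blocks, this is the map to the merged diagram that plays the role of \<open>f\<close>
  in \<open>noncrossing_coarser\<close>.\<close>

definition merged_block :: "vertex \<Rightarrow> vertex \<Rightarrow> diagram \<Rightarrow> vertex set \<Rightarrow> vertex set" where
  "merged_block u v \<sigma> B =
     (if u \<in> B \<or> v \<in> B then \<Union>{B \<in> blocks \<sigma>. u \<in> B \<or> v \<in> B} else B)"

lemma merged_block_in_blocks:
  "B \<in> blocks \<sigma> \<Longrightarrow> merged_block u v \<sigma> B \<in> blocks (merge_blocks u v \<sigma>)"
  by (auto simp: merged_block_def blocks_merge_blocks)

lemma merged_block_superset: "B \<in> blocks \<sigma> \<Longrightarrow> B \<subseteq> merged_block u v \<sigma> B"
  by (auto simp: merged_block_def)

text \<open>Merging identifies only the block of \<open>u\<close> with that of \<open>v\<close>. A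
  family that misses one of the two vertices has at most one affected member, so its members stay
  distinct.\<close>

lemma inj_on_merged_block:
  assumes "F \<subseteq> blocks \<sigma>" "(\<forall>B\<in>F. u \<notin> B) \<or> (\<forall>B\<in>F. v \<notin> B)"
  shows "inj_on (merged_block u v \<sigma>) F"
proof (rule inj_onI)
  fix B C assume B: "B \<in> F" and C: "C \<in> F" and eq: "merged_block u v \<sigma> B = merged_block u v \<sigma> C"
  have bl: "B \<in> blocks \<sigma>" "C \<in> blocks \<sigma>" using B C assms(1) by auto
  \<comment> \<open>If one of the two vertices occurs in the family, the other does not, so a member
    without \<open>w\<close> is left unchanged.\<close>
  have mem: "w \<in> merged_block u v \<sigma> D \<longleftrightarrow> w \<in> D"
    if "D \<in> F" "w = u \<or> w = v" "\<exists>E\<in>F. w \<in> E" for w D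
  proof
    assume w: "w \<in> merged_block u v \<sigma> D"
    show "w \<in> D"
    proof (rule ccontr)
      assume "w \<notin> D"
      moreover from this have "merged_block u v \<sigma> D = D"
        using that assms(2) by (auto simp: merged_block_def)
      ultimately show False using w by simp
    qed
  qed (use merged_block_superset assms(1) that in blast)
  show "B = C"
  proof (cases "\<exists>w. (w = u \<or> w = v) \<and> (w \<in> B \<or> w \<in> C)")
    case True
    then obtain w where w: "w = u \<or> w = v" "w \<in> B \<or> w \<in> C" by blast
    then have "w \<in> B" "w \<in> C"
      using mem[OF B w(1)] mem[OF C w(1)] B C eq by auto
    then show ?thesis by (rule blocks_disjoint[OF bl])
  next
    case False
    then have "u \<notin> B" "v \<notin> B" "u \<notin> C" "v \<notin> C" by blast+
    then show ?thesis using eq by (simp add: merged_block_def)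
  qed
qed

text \<open>The vertex \<open>v\<close> lies in no block of the first factor and \<open>u\<close> in
  no shifted block of the second, so \<open>inj_on_merged_block\<close> keeps the blocks of each
  factor distinct.\<close>

lemma noncrossing_bulletD:
  assumes nc: "noncrossing (blocks (\<pi> \<bullet>\<^sub>D \<rho>))"
  shows "noncrossing (blocks \<pi>)" "noncrossing (blocks \<rho>)"
proof -
  define k u v where "k = diagram_order \<pi>" and "u = Bot k" and "v = Bot (k + 1)"
  define f where "f = merged_block u v (\<pi> + \<rho>)"
  have \<pi>: "blocks \<pi> \<subseteq> blocks (\<pi> + \<rho>)" and \<rho>: "(`) (shift k) ` blocks \<rho> \<subseteq> blocks (\<pi> + \<rho>)"
    by (auto simp: blocks_add k_def)
  have "v \<notin> B" if "B \<in> blocks \<pi>" for B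
  proof
    assume "v \<in> B"
    then have "v \<in> vertices k" using blocks_subset[OF that] by (auto simp: k_def)
    then show False by (auto simp: v_def vertices_def)
  qed
  then have inj1: "inj_on f (blocks \<pi>)"
    unfolding f_def by (intro inj_on_merged_block[OF \<pi>]) simp
  have "u \<notin> shift k ` B" if "B \<in> blocks \<rho>" for B
  proof
    assume "u \<in> shift k ` B"
    then have "u \<in> shift k ` vertices (diagram_order \<rho>)" using blocks_subset[OF that] by auto
    then show False by (auto simp: u_def vertices_def)
  qed
  then have inj2: "inj_on f ((`) (shift k) ` blocks \<rho>)"
    unfolding f_def by (intro inj_on_merged_block[OF \<rho>]) simp
  have nc_0: "noncrossing (blocks 0)" by (simp add: noncrossing_def blocks_0)
  consider "\<pi> = 0" | "\<rho> = 0" | "\<pi> \<noteq> 0" "\<rho> \<noteq> 0" by blast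
  then have "noncrossing (blocks \<pi>) \<and> noncrossing (blocks \<rho>)"
  proof cases
    case 3
    then have nc: "noncrossing (blocks (merge_blocks u v (\<pi> + \<rho>)))"
      using nc by (simp add: bullet_def u_def v_def k_def)
    have f: "f B \<in> blocks (merge_blocks u v (\<pi> + \<rho>))" "B \<subseteq> f B" if "B \<in> blocks (\<pi> + \<rho>)" for B
      unfolding f_def using that by (rule merged_block_in_blocks merged_block_superset)+
    have "noncrossing (blocks \<pi>)"
      by (rule noncrossing_coarser[OF nc, where f = f and k = 0])
        (use f \<pi> inj1 in \<open>auto simp: shift_0\<close>)
    moreover have "noncrossing (blocks \<rho>)"
    proof (rule noncrossing_coarser[OF nc, where f = "f \<circ> (`) (shift k)" and k = k])
      show "inj_on (f \<circ> (`) (shift k)) (blocks \<rho>)"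
        by (rule comp_inj_on[OF inj_on_subset[OF inj_image_shift subset_UNIV] inj2])
    qed (use f \<rho> in auto)
    ultimately show ?thesis by blast
  qed (use nc nc_0 in \<open>simp_all add: bullet_def split: if_splits\<close>)
  then show "noncrossing (blocks \<pi>)" "noncrossing (blocks \<rho>)" by blast+
qed

section \<open>Planarity under the two products\<close>

lemma planar_0: "planar 0"
  by (simp add: planar_iff_noncrossing noncrossing_def blocks_0)

lemma planar_add_iff: "planar (\<pi> + \<rho>) \<longleftrightarrow> planar \<pi> \<and> planar \<rho>"
  unfolding planar_iff_noncrossing using noncrossing_add noncrossing_addD by blast

lemma planar_sum_list: "planar (sum_list \<pi>s) \<Longrightarrow> \<pi> \<in> set \<pi>s \<Longrightarrow> planar \<pi>"
  by (induction \<pi>s) (auto simp: planar_add_iff)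

lemma planar_bulletD: "planar (\<pi> \<bullet>\<^sub>D \<rho>) \<Longrightarrow> planar \<pi> \<and> planar \<rho>"
  unfolding planar_iff_noncrossing using noncrossing_bulletD by blast

lemma planar_foldr_bullet: "planar (foldr (\<bullet>\<^sub>D) \<pi>s 0) \<Longrightarrow> \<pi> \<in> set \<pi>s \<Longrightarrow> planar \<pi>"
  by (induction \<pi>s) (auto dest: planar_bulletD)

section \<open>The Hopf subalgebra\<close>

lemma span_mult_closed:
  fixes X :: "('a::monoid_add \<Rightarrow>\<^sub>0 'k::field) set"
  assumes X: "\<And>x y. x \<in> X \<Longrightarrow> y \<in> X \<Longrightarrow> x * y \<in> free_module.span X"
    and p: "p \<in> free_module.span X" and q: "q \<in> free_module.span X"
  shows "p * q \<in> free_module.span X"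
proof -
  have "x * q \<in> free_module.span X" if x: "x \<in> X" for x
    using q
  proof (induction rule: free_module.span_induct_alt)
    case base
    then show ?case by (simp add: free_module.span_zero)
  next
    case (step c y q)
    then show ?case
      by (simp add: distrib_left scale_mult_right free_module.span_add free_module.span_scale X x)
  qed
  with p show ?thesis
  proof (induction rule: free_module.span_induct_alt)
    case base
    then show ?case by (simp add: free_module.span_zero)
  next
    case (step c x p)
    then show ?case
      by (simp add: distrib_right scale_mult_left free_module.span_add free_module.span_scale)
  qed
qed

lemma H_mult_in_span:
  assumes "\<And>\<pi> \<rho>. P \<pi> \<Longrightarrow> P \<rho> \<Longrightarrow> P (\<pi> + \<rho>)"
    and "p \<in> free_module.span {H \<pi> :: 'k::field parsym |\<pi>. P \<pi>}"
      "q \<in> free_module.span {H \<pi> |\<pi>. P \<pi>}"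
  shows "p * q \<in> free_module.span {H \<pi> |\<pi>. P \<pi>}"
proof (rule span_mult_closed)
  fix x y :: "'k parsym"
  assume "x \<in> {H \<pi> |\<pi>. P \<pi>}" "y \<in> {H \<pi> |\<pi>. P \<pi>}"
  then obtain \<pi> \<rho> where "x = H \<pi>" "P \<pi>" "y = H \<rho>" "P \<rho>" by blast
  then have "x * y = H (\<pi> + \<rho>)" "P (\<pi> + \<rho>)" using assms(1) by (simp_all add: H_add)
  then show "x * y \<in> free_module.span {H \<pi> |\<pi>. P \<pi>}"
    by (auto intro: free_module.span_base)
qed (fact assms(2,3))+

lemma tensor_H_mult_in_span:
  assumes "\<And>\<pi> \<rho>. P \<pi> \<Longrightarrow> P \<rho> \<Longrightarrow> P (\<pi> + \<rho>)"
    and pq: "p \<in> free_module.span {tensor (H \<pi>) (H \<rho>) :: 'k::field parsym2 |\<pi> \<rho>. P \<pi> \<and> P \<rho>}"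
      "q \<in> free_module.span {tensor (H \<pi>) (H \<rho>) |\<pi> \<rho>. P \<pi> \<and> P \<rho>}"
  shows "p * q \<in> free_module.span {tensor (H \<pi>) (H \<rho>) |\<pi> \<rho>. P \<pi> \<and> P \<rho>}"
  using pq
proof (rule span_mult_closed[rotated])
  fix x y :: "'k parsym2"
  assume "x \<in> {tensor (H \<pi>) (H \<rho>) |\<pi> \<rho>. P \<pi> \<and> P \<rho>}" "y \<in> {tensor (H \<pi>) (H \<rho>) |\<pi> \<rho>. P \<pi> \<and> P \<rho>}"
  then obtain \<pi> \<rho> \<pi>' \<rho>' where "x = tensor (H \<pi>) (H \<rho>)" "y = tensor (H \<pi>') (H \<rho>')"
    "P \<pi>" "P \<rho>" "P \<pi>'" "P \<rho>'" by blast
  then have "x * y = tensor (H (\<pi> + \<pi>')) (H (\<rho> + \<rho>'))" "P (\<pi> + \<pi>')" "P (\<rho> + \<rho>')"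
    using assms(1) by (simp_all add: tensor_H mult_single plus_prod_def)
  then show "x * y \<in> free_module.span {tensor (H \<pi>) (H \<rho>) |\<pi> \<rho>. P \<pi> \<and> P \<rho>}"
    by (auto intro: free_module.span_base)
qed

text \<open>All irreducible factors of a planar diagram are planar, so the values on these suffice.
  The hypothesis \<open>add\<close> leaves the order of the factors open, which lets the lemma serve
  both the coproduct and the order-reversing antipode.\<close>

lemma linear_image_of_planar_span:
  fixes D :: "'k::field parsym \<Rightarrow> ('b \<Rightarrow>\<^sub>0 'k)"
  assumes D: "Vector_Spaces.linear scalar_mult scalar_mult D"
    and W: "free_module.subspace W"
    and zero: "D (H 0) \<in> W"
    and add: "\<And>\<pi> \<rho>. D (H \<pi>) \<in> W \<Longrightarrow> D (H \<rho>) \<in> W \<Longrightarrow> D (H (\<pi> + \<rho>)) \<in> W"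
    and irreducible: "\<And>\<pi>. planar \<pi> \<Longrightarrow> \<pi> \<noteq> 0 \<Longrightarrow> tensor_irreducible \<pi> \<Longrightarrow> D (H \<pi>) \<in> W"
    and p: "p \<in> free_module.span {H \<pi> |\<pi>. planar \<pi>}"
  shows "D p \<in> W"
proof -
  interpret D: Vector_Spaces.linear scalar_mult scalar_mult D by (rule D)
  have sum_list: "D (H (sum_list \<pi>s)) \<in> W"
    if "irreducible_factors \<pi>s" "\<forall>\<pi>\<in>set \<pi>s. planar \<pi>" for \<pi>s
    using that
    by (induction \<pi>s) (auto simp: zero irreducible_factors_def intro!: add irreducible)
  have "D (H \<pi>) \<in> W" if "planar \<pi>" for \<pi>
    using sum_list[OF factors(1)[of \<pi>]] factors(2)[of \<pi>] planar_sum_list[of "factors \<pi>"] that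
    by auto
  then have "{H \<pi> |\<pi>. planar \<pi>} \<subseteq> {p. D p \<in> W}" by blast
  moreover have "free_module.subspace {p. D p \<in> W}"
    by (rule D.subspace_vimage[OF W, unfolded vimage_def])
  ultimately show ?thesis using free_module.span_minimal p by blast
qed

theorem theorem4p1:
  shows "hopf_subalgebra (free_module.span {H \<pi> :: 'k::field parsym |\<pi>. planar \<pi>})"
proof -
  let ?W = "free_module.span {H \<pi> :: 'k parsym |\<pi>. planar \<pi>}"
  \<comment> \<open>Products of these basis tensors are again such tensors, which makes
    \<open>?T\<close> more convenient than the tensor square that contains it.\<close>
  let ?T = "free_module.span {tensor (H \<pi>) (H \<rho>) :: 'k parsym2 |\<pi> \<rho>. planar \<pi> \<and> planar \<rho>}"
  have H_W: "H \<pi> \<in> ?W" if "planar \<pi>" for \<pi>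
    using that by (auto intro: free_module.span_base)
  have mult_W: "p * q \<in> ?W" if "p \<in> ?W" "q \<in> ?W" for p q
    using that by (intro H_mult_in_span) (simp_all add: planar_add_iff)
  have tensor_T: "tensor (H \<pi>) (H \<rho>) \<in> ?T" if "planar \<pi>" "planar \<rho>" for \<pi> \<rho>
    by (rule free_module.span_base) (use that in blast)
  have T: "?T \<subseteq> tensor_square ?W"
    unfolding tensor_square_def using H_W by (intro free_module.span_mono) blast
  have comult: "comult p \<in> ?T" if "p \<in> ?W" for p
  proof -
    have "comult_spec (comult :: 'k parsym \<Rightarrow> 'k parsym2)" by (rule comult_spec)
    note spec = this[unfolded comult_spec_def]
    show ?thesis
    proof (rule linear_image_of_planar_span[OF spec[THEN conjunct1] _ _ _ _ that])
      show "comult (H 0) \<in> ?T"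
        unfolding spec[THEN conjunct2, THEN conjunct1] by (intro tensor_T planar_0)
      show "comult (H (\<pi> + \<rho>)) \<in> ?T" if "comult (H \<pi>) \<in> ?T" "comult (H \<rho>) \<in> ?T" for \<pi> \<rho>
        using that unfolding H_add spec[THEN conjunct2, THEN conjunct2, THEN conjunct1, rule_format]
        by (intro tensor_H_mult_in_span) (simp_all add: planar_add_iff)
      \<comment> \<open>In each term the two diagrams have the planar bullet product
        \<open>\<pi>\<close>, so both are planar by \<open>planar_bulletD\<close>.\<close>
      show "comult (H \<pi>) \<in> ?T" if "planar \<pi>" "\<pi> \<noteq> 0" "tensor_irreducible \<pi>" for \<pi>
        unfolding spec[THEN conjunct2, THEN conjunct2, THEN conjunct2, rule_format, OF conjI[OF that(2,3)]]
        by (rule free_module.span_sum) (use that(1) in \<open>auto dest!: planar_bulletD intro!: tensor_T\<close>)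
    qed simp
  qed
  have antipode: "antipode p \<in> ?W" if "p \<in> ?W" for p
  proof -
    have "antipode_spec (antipode :: 'k parsym \<Rightarrow> 'k parsym)" by (rule antipode_spec)
    note spec = this[unfolded antipode_spec_def]
    have prod_W: "prod_list (map H \<rho>s) \<in> ?W" if "\<forall>\<rho>\<in>set \<rho>s. planar \<rho>" for \<rho>s
      using that by (induction \<rho>s) (auto intro: mult_W H_W simp: H_W[OF planar_0, unfolded H_0])
    show ?thesis
    proof (rule linear_image_of_planar_span[OF spec[THEN conjunct1] _ _ _ _ that])
      show "antipode (H 0) \<in> ?W"
        unfolding spec[THEN conjunct2, THEN conjunct1] by (rule H_W[OF planar_0])
      show "antipode (H (\<pi> + \<rho>)) \<in> ?W" if "antipode (H \<pi>) \<in> ?W" "antipode (H \<rho>) \<in> ?W" for \<pi> \<rho>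
        unfolding H_add spec[THEN conjunct2, THEN conjunct2, THEN conjunct1, rule_format] using that by (intro mult_W)
      \<comment> \<open>Signs are absorbed as scalars, and the entries of each tuple are planar by
        \<open>planar_foldr_bullet\<close>.\<close>
      show "antipode (H \<pi>) \<in> ?W" if "planar \<pi>" "\<pi> \<noteq> 0" "tensor_irreducible \<pi>" for \<pi>
        unfolding spec[THEN conjunct2, THEN conjunct2, THEN conjunct2, rule_format, OF conjI[OF that(2,3)]]
        by (intro free_module.span_sum free_module.span_scale prod_W)
          (use planar_foldr_bullet that(1) in auto)
    qed simp
  qed
  show ?thesis
    unfolding hopf_subalgebra_def
    using H_W[OF planar_0] mult_W comult T antipode free_module.subspace_span by blast
qed

end
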